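(* $\mathcal{L}$ attains its minimum in $\mathcal{C}$, i.e. there is $W_\infty\in\mathcal{C}$ with $\mathcal{L}(W_\infty)=\inf_{W\in\mathcal{C}}\mathcal{L}(W)$. More precisely: (i) $\mathcal{L}$ is weakly lower semicontinuous on $\widetilde{\mathcal{C}}_0$, i.e. if $\widetilde W_n,\widetilde W_\infty\in\widetilde{\mathcal{C}}_0$ and $\widetilde W_n\rightharpoonup\widetilde W_\infty$ weakly in $L^2$, then $\mathcal{L}(W_{\rm sh}-\widetilde W_\infty)\le\liminf_n\mathcal{L}(W_{\rm sh}-\widetilde W_n)$; (ii) each minimising sequence $(W_n)_n\subset\mathcal{C}_0$ (i.e. $\mathcal{L}(W_n)\to\inf_{\mathcal{C}}\mathcal{L}$) has a subsequence such that $W_{\rm sh}-W_n$ converges strongly in $L^2$.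
   Context: Let $\Phi:\mathbb{R}\to\mathbb{R}$ be twice continuously differentiable on $[-1,1]$ with: $\Phi'(-1)=-1$, $\Phi'(1)=1$; $\Phi''\ge0$ on $[-1,1]$; $\Phi(-1)=\Phi(1)$; $\Phi''(-1)<1$, $\Phi''(1)<1$; and $g_\Phi(w):=\int_{-1}^w(v-\Phi'(v))\,dv>0$ for all $w\in(-1,1)$. $(\mathcal{A}U)(\varphi)=\int_{\varphi-1/2}^{\varphi+1/2}U(s)\,ds$; $W_{\rm sh}(\varphi)=\mathrm{sgn}(\varphi)$; $\mathcal{H}=\{W\text{ measurable}: W_{\rm sh}-W\in L^2(\mathbb{R})\}$; $\mathcal{L}(W)=\int_{\mathbb{R}}(\tfrac12W^2-\Phi(\mathcal{A}W))-(\tfrac12W_{\rm sh}^2-\Phi(\mathcal{A}W_{\rm sh}))\,d\varphi$. $\mathcal{C}$ is the set of $W\in\mathcal{H}$ that are a.e. equal to a nondecreasing function with $W(\varphi)\to\pm1$ as $\varphi\to\pm\infty$; $\mathcal{C}_0$ is the set of $W\in\mathcal{C}$ with $0\le W\le1$ a.e. on $[0,\infty)$ and $-1\le W\le0$ a.e. on $(-\infty,0]$; $\widetilde{\mathcal{C}}_0=\{W_{\rm sh}-W: W\in\mathcal{C}_0\}$. *)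

theory Defs
  imports "HOL-Analysis.Analysis"
begin

definition L2 :: "(real \<Rightarrow> real) set" where
  "L2 = {f. f \<in> borel_measurable lebesgue \<and> integrable lebesgue (\<lambda>x. (f x)\<^sup>2)}"

definition weak_L2_conv :: "(nat \<Rightarrow> real \<Rightarrow> real) \<Rightarrow> (real \<Rightarrow> real) \<Rightarrow> bool" where
  "weak_L2_conv fs f \<longleftrightarrow>
     (\<forall>g\<in>L2. (\<lambda>n. integral\<^sup>L lebesgue (\<lambda>x. fs n x * g x))
               \<longlonglongrightarrow> integral\<^sup>L lebesgue (\<lambda>x. f x * g x))"

definition opA :: "(real \<Rightarrow> real) \<Rightarrow> real \<Rightarrow> real" where
  "opA U \<phi> = (LINT s:{\<phi> - 1/2..\<phi> + 1/2}|lebesgue. U s)"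

definition Wsh :: "real \<Rightarrow> real" where
  "Wsh \<phi> = sgn \<phi>"

definition Hsp :: "(real \<Rightarrow> real) set" where
  "Hsp = {W. W \<in> borel_measurable lebesgue \<and> (\<lambda>x. Wsh x - W x) \<in> L2}"

definition Lag :: "(real \<Rightarrow> real) \<Rightarrow> (real \<Rightarrow> real) \<Rightarrow> real" where
  "Lag \<Phi> W = integral\<^sup>L lebesgue
     (\<lambda>\<phi>. ((1/2) * (W \<phi>)\<^sup>2 - \<Phi> (opA W \<phi>)) - ((1/2) * (Wsh \<phi>)\<^sup>2 - \<Phi> (opA Wsh \<phi>)))"

definition Cset :: "(real \<Rightarrow> real) set" where
  "Cset = {W. W \<in> Hsp \<and> (\<exists>V. mono V \<and> (AE x in lebesgue. W x = V x)
                 \<and> (V \<longlongrightarrow> 1) at_top \<and> (V \<longlongrightarrow> -1) at_bot)}"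

definition C0set :: "(real \<Rightarrow> real) set" where
  "C0set = {W. W \<in> Cset
               \<and> (AE x in lebesgue. 0 \<le> x \<longrightarrow> 0 \<le> W x \<and> W x \<le> 1)
               \<and> (AE x in lebesgue. x \<le> 0 \<longrightarrow> -1 \<le> W x \<and> W x \<le> 0)}"

definition C0tilde :: "(real \<Rightarrow> real) set" where
  "C0tilde = (\<lambda>W x. Wsh x - W x) ` C0set"

end

theory Submission
  imports Defs "HOL-Probability.Helly_Selection"
begin

text \<open>
  Put \<open>g(w) = w\<^sup>2/2 - \<Phi>(w) - (1/2 - \<Phi>(1))\<close>. The hypotheses on \<open>\<Phi>\<close> imply that \<open>g\<close> is comparable
  to \<open>(1 - |w|)\<^sup>2\<close> on \<open>[-1,1]\<close>. Since \<open>\<integral>(A(V\<^sup>2) - V\<^sup>2) = 0\<close> for every monotone front, the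
  Lagrangian is, up to an additive constant, the integral of the nonnegative density
  \<open>(A(V\<^sup>2) - (AV)\<^sup>2)/2 + g(AV)\<close>, which depends continuously on \<open>V\<close> under bounded almost everywhere
  convergence. Weak convergence of monotone functions implies almost everywhere convergence, so
  Fatou's lemma gives lower semicontinuity. Minimising sequences, translated so that they change
  sign at 0, converge almost everywhere along a subsequence by Helly's theorem; the lower bound on
  \<open>g\<close> makes the density control \<open>(Wsh - V)\<^sup>2\<close>, which forces the limit to be a front and, together
  with convergence of the energies, upgrades the convergence to \<open>L\<^sup>2\<close>.
\<close>

section \<open>The moving average\<close>

text \<open>Two obstacles shape the argument. First, \<open>Lag\<close> compares the local term
  \<open>(V x)\<^sup>2 / 2\<close> with the square of an average, and
  \<open>(V x)\<^sup>2 / 2 - (opA V x)\<^sup>2 / 2\<close> has no sign, so Fatou's lemma does not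
  apply to it. Replacing the local square by its own average turns the difference into a variance.
  The exchange costs nothing because a monotone front has unit increments of total integral 2: they
  dominate every error term without any assumed rate of decay, and \<open>V\<^sup>2\<close> has the
  same limit 1 at both ends. Second, the double well only sees \<bar>AV\<bar>, while the goal
  concerns \<open>V\<close> itself. The same normalisation removes the freedom to translate, which
  would otherwise let minimising sequences drift away. The constant \<open>1/2 - \<Phi>(1)\<close>
  makes \<open>g\<close> vanish at both wells; on \<open>[-1,1]\<close> this \<open>g\<close> is the
  integral of \<open>v - \<Phi>' v\<close> from -1, positive inside by hypothesis.\<close>

definition unit_window :: "real measure" where
  "unit_window = restrict_space lborel {-1/2..1/2}"

lemma space_unit_window [simp]: "space unit_window = {-1/2..1/2}"
  by (simp add: unit_window_def space_restrict_space)

lemma borel_measurable_unit_window: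
  "f \<in> borel_measurable borel \<Longrightarrow> f \<in> borel_measurable unit_window"
  unfolding unit_window_def by (simp add: measurable_restrict_space1)

interpretation window: prob_space unit_window
  by (rule prob_spaceI) (simp add: unit_window_def emeasure_restrict_space space_restrict_space)

interpretation lborel_window: pair_sigma_finite lborel unit_window ..

text \<open>Writing the average as an expectation over a fixed probability space makes constants
  integrable, turns Jensen's inequality into positivity of a variance, and prepares the Fubini
  argument.\<close>

lemma opA_window:
  assumes [measurable]: "U \<in> borel_measurable borel"
  shows "opA U \<phi> = (\<integral>s. U (\<phi> + s) \<partial>unit_window)"
proof -
  have "opA U \<phi> = (\<integral>s. indicator {\<phi> - 1/2..\<phi> + 1/2} s * U s \<partial>lborel)"
    unfolding opA_def set_lebesgue_integral_def by (subst integral_completion) simp_all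
  also have "\<dots> = (\<integral>s. indicator {\<phi> - 1/2..\<phi> + 1/2} (\<phi> + s) * U (\<phi> + s) \<partial>lborel)"
    by (subst lborel_integral_real_affine[where c = 1 and t = \<phi>]) simp_all
  also have "\<dots> = (\<integral>s. indicator {-1/2..1/2} s * U (\<phi> + s) \<partial>lborel)"
    by (rule Bochner_Integration.integral_cong) (auto simp: indicator_def)
  also have "\<dots> = (\<integral>s. U (\<phi> + s) \<partial>unit_window)"
    unfolding unit_window_def by (subst integral_restrict_space) auto
  finally show ?thesis .
qed

lemma opA_cong_AE:
  assumes "AE x in lebesgue. U x = V x" "U \<in> borel_measurable lebesgue" "V \<in> borel_measurable lebesgue"
  shows "opA U = opA V"
proof
  fix \<phi>
  show "opA U \<phi> = opA V \<phi>"
    unfolding opA_def by (rule set_lebesgue_integral_cong_AE) (use assms in auto)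
qed

text \<open>\<open>M\<close> is left open because both \<open>borel\<close> (measurability of
  \<open>opA U\<close>) and \<open>lborel\<close> (Fubini) are needed.\<close>

lemma borel_measurable_pair_window:
  assumes [measurable]: "U \<in> borel_measurable borel" and "sets M = sets (borel :: real measure)"
  shows "(\<lambda>(p, s). U (p + s)) \<in> borel_measurable (M \<Otimes>\<^sub>M unit_window)"
proof -
  have [measurable]: "fst \<in> borel_measurable (M \<Otimes>\<^sub>M unit_window)"
    using measurable_fst[of M unit_window] assms(2) by (simp cong: measurable_cong_sets)
  have [measurable]: "snd \<in> borel_measurable (M \<Otimes>\<^sub>M unit_window)"
    using measurable_compose[OF measurable_snd borel_measurable_unit_window[of "\<lambda>x. x"]] by simp
  show ?thesis unfolding case_prod_beta by measurable
qed

lemma opA_borel_measurable [measurable]: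
  assumes [measurable]: "U \<in> borel_measurable borel"
  shows "opA U \<in> borel_measurable borel"
proof -
  have *: "opA U = (\<lambda>\<phi>. \<integral>s. U (\<phi> + s) \<partial>unit_window)"
    using opA_window[OF assms] by auto
  have [measurable]: "(\<lambda>(p, s). U (p + s)) \<in> borel_measurable (borel \<Otimes>\<^sub>M unit_window)"
    by (rule borel_measurable_pair_window) auto
  show ?thesis unfolding * by measurable
qed

text \<open>Lebesgue null sets are translation invariant, so an almost everywhere statement holds
  almost everywhere on every single window. This is why averages converge at each point and not
  merely almost everywhere.\<close>

lemma AE_shift_window:
  assumes "AE x in lborel. P x"
  shows "AE s in unit_window. P (\<phi> + s)"
proof -
  obtain N where N: "{x. \<not> P x} \<subseteq> N" "emeasure lborel N = 0" "N \<in> sets lborel"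
    using AE_E[OF assms] by auto
  have [measurable]: "N \<in> sets borel" using N(3) by simp
  have "AE x in lborel. x \<notin> N" by (rule AE_not_in) (use N in auto)
  then have "AE s in lborel. \<phi> + 1 * s \<notin> N"
    by (intro AE_borel_affine) auto
  then have "AE s in lborel. P (\<phi> + s)"
    by eventually_elim (use N(1) in auto)
  then show ?thesis unfolding unit_window_def by (subst AE_restrict_space_iff) auto
qed


lemma integrable_window:
  fixes B :: real
  assumes "U \<in> borel_measurable borel" "\<And>x. \<bar>U x\<bar> \<le> B"
  shows "integrable unit_window (\<lambda>s. U (\<phi> + s))"
  by (rule window.integrable_const_bound[where B = B])
     (use assms in \<open>auto intro: borel_measurable_unit_window\<close>)

lemma opA_le:
  fixes B :: real
  assumes "U \<in> borel_measurable borel" "\<And>x. \<bar>U x\<bar> \<le> B"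
    and "\<And>x. \<phi> - 1/2 \<le> x \<Longrightarrow> x \<le> \<phi> + 1/2 \<Longrightarrow> U x \<le> b"
  shows "opA U \<phi> \<le> b"
  unfolding opA_window[OF assms(1)]
  by (rule window.integral_le_const) (use integrable_window[OF assms(1,2)] assms(3) in auto)

lemma opA_ge:
  fixes B :: real
  assumes "U \<in> borel_measurable borel" "\<And>x. \<bar>U x\<bar> \<le> B"
    and "\<And>x. \<phi> - 1/2 \<le> x \<Longrightarrow> x \<le> \<phi> + 1/2 \<Longrightarrow> b \<le> U x"
  shows "b \<le> opA U \<phi>"
  unfolding opA_window[OF assms(1)]
  by (rule window.integral_ge_const) (use integrable_window[OF assms(1,2)] assms(3) in auto)

text \<open>The difference of the two sides is a variance over the window.\<close>

lemma opA_square_le: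
  fixes B :: real
  assumes "U \<in> borel_measurable borel" "\<And>x. \<bar>U x\<bar> \<le> B"
  shows "(opA U \<phi>)\<^sup>2 \<le> opA (\<lambda>x. (U x)\<^sup>2) \<phi>"
proof -
  have B2: "\<bar>(U x)\<^sup>2\<bar> \<le> B\<^sup>2" for x
    using assms(2)[of x] by (simp add: abs_le_square_iff[symmetric])
  have "0 \<le> window.variance (\<lambda>s. U (\<phi> + s))" by (rule window.variance_positive)
  also have "\<dots> = opA (\<lambda>x. (U x)\<^sup>2) \<phi> - (opA U \<phi>)\<^sup>2"
    using assms(1) integrable_window[OF assms] integrable_window[of "\<lambda>x. (U x)\<^sup>2", OF _ B2]
    by (subst window.variance_eq) (auto simp: opA_window)
  finally show ?thesis by simp
qed

lemma opA_tendsto: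
  fixes B :: real
  assumes "\<And>n. U n \<in> borel_measurable borel" "V \<in> borel_measurable borel"
    and "\<And>n x. \<bar>U n x\<bar> \<le> B" and "AE x in lborel. (\<lambda>n. U n x) \<longlonglongrightarrow> V x"
  shows "(\<lambda>n. opA (U n) \<phi>) \<longlonglongrightarrow> opA V \<phi>"
  unfolding opA_window[OF assms(1)] opA_window[OF assms(2)]
  by (rule integral_dominated_convergence[where w = "\<lambda>_. B"])
     (use AE_shift_window[OF assms(4)] assms(1-3) in \<open>auto intro!: borel_measurable_unit_window\<close>)

lemma opA_shift:
  assumes "U \<in> borel_measurable borel"
  shows "opA (\<lambda>x. U (x + a)) \<phi> = opA U (\<phi> + a)"
  using assms by (simp add: opA_window algebra_simps)

section \<open>Integrals over the line of increments of bounded functions\<close>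

lemma integrable_abs_le:
  fixes f :: "'a \<Rightarrow> real"
  assumes "integrable M G" "f \<in> borel_measurable M" "\<And>x. \<bar>f x\<bar> \<le> G x"
  shows "integrable M f"
  by (rule Bochner_Integration.integrable_bound[OF assms(1,2)])
     (use assms(3) in \<open>auto intro: order_trans[OF _ abs_ge_self]\<close>)

lemma integrable_Icc_bounded:
  fixes f :: "real \<Rightarrow> real"
  assumes [measurable]: "f \<in> borel_measurable borel" and "\<And>x. \<bar>f x\<bar> \<le> B"
  shows "integrable lborel (\<lambda>x. indicator {a..b} x * f x)"
proof (rule Bochner_Integration.integrable_bound[where f = "\<lambda>x. B * indicator {a..b} x"])
  show "AE x in lborel. norm (indicator {a..b} x * f x) \<le> norm (B * indicator {a..b} x)"
    using assms(2) by (intro AE_I2) (auto simp: indicator_def intro: order_trans[OF _ abs_ge_self])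
qed (auto simp: integrable_indicator_iff emeasure_lborel_Icc_eq)

lemma integral_shift:
  fixes f :: "real \<Rightarrow> real"
  shows "(\<integral>x. f (x + a) \<partial>lborel) = (\<integral>x. f x \<partial>lborel)"
  using lborel_integral_real_affine[of 1 f a] by (simp add: add.commute)

lemma integrable_shift:
  fixes f :: "real \<Rightarrow> real"
  assumes "integrable lborel f"
  shows "integrable lborel (\<lambda>x. f (x + a))"
  using lborel_integrable_real_affine[OF assms, of 1 a] by (simp add: add.commute)

text \<open>After translation the interval stays at \<open>{0..s}\<close> and dominated convergence
  applies. The filter \<open>F\<close> stands for \<open>at_top\<close> or \<open>at_bot\<close>;
  \<open>tr\<close> is the translation invariance that both share.\<close>

lemma tendsto_integral_moving_interval:
  fixes f :: "real \<Rightarrow> real"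
  assumes [measurable]: "f \<in> borel_measurable borel" and B: "\<And>x. \<bar>f x\<bar> \<le> B"
    and lim: "(f \<longlongrightarrow> l) F" and p: "filterlim p F sequentially"
    and tr: "\<And>t. filterlim (\<lambda>x. x + t) F F" and "0 \<le> s"
  shows "(\<lambda>n. \<integral>x. indicator {0..s} (x - p n) * f x \<partial>lborel) \<longlonglongrightarrow> s * l"
proof -
  have "(\<lambda>n. \<integral>t. indicator {0..s} t * f (t + p n) \<partial>lborel) \<longlonglongrightarrow> (\<integral>t. indicator {0..s} t * l \<partial>lborel)"
  proof (rule integral_dominated_convergence[where w = "\<lambda>t. B * indicator {0..s} t"])
    show "AE t in lborel. (\<lambda>n. indicator {0..s} t * f (t + p n)) \<longlonglongrightarrow> indicator {0..s} t * l"
    proof (rule AE_I2)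
      fix t
      have "filterlim (\<lambda>n. p n + t) F sequentially"
        using filterlim_compose[OF tr p] .
      then have "(\<lambda>n. f (p n + t)) \<longlonglongrightarrow> l"
        by (rule filterlim_compose[OF lim])
      then show "(\<lambda>n. indicator {0..s} t * f (t + p n)) \<longlonglongrightarrow> indicator {0..s} t * l"
        by (intro tendsto_intros) (simp add: add.commute)
    qed
  next
    fix n show "AE t in lborel. norm (indicator {0..s} t * f (t + p n)) \<le> B * indicator {0..s} t"
      using B by (auto simp: indicator_def)
  qed (auto simp: integrable_indicator_iff emeasure_lborel_Icc_eq)
  moreover have "(\<integral>t. indicator {0..s} t * f (t + p n) \<partial>lborel)
    = (\<integral>x. indicator {0..s} (x - p n) * f x \<partial>lborel)" for n
    using integral_shift[of "\<lambda>x. indicator {0..s} (x - p n) * f x" "p n"] by simp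
  moreover have "(\<integral>t. indicator {0..s} t * l \<partial>lborel) = s * l"
    using \<open>0 \<le> s\<close> by simp
  ultimately show ?thesis by (simp only:)
qed

text \<open>Telescoping: the integrals of \<open>f (x + s)\<close> and \<open>f x\<close> over a
  long interval cancel except on two end pieces of length \<open>s\<close>, where \<open>f\<close>
  is close to its limits.\<close>

lemma tendsto_integral_increment:
  fixes f :: "real \<Rightarrow> real"
  assumes [measurable]: "f \<in> borel_measurable borel" and B: "\<And>x. \<bar>f x\<bar> \<le> B"
    and top: "(f \<longlongrightarrow> b) at_top" and bot: "(f \<longlongrightarrow> a) at_bot" and "0 \<le> s"
  shows "(\<lambda>n. \<integral>x. indicator {- real n..real n} x * (f (x + s) - f x) \<partial>lborel) \<longlonglongrightarrow> s * (b - a)"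
proof -
  have "(\<lambda>n. (\<integral>x. indicator {0..s} (x - real n) * f x \<partial>lborel)
      - (\<integral>x. indicator {0..s} (x - - real n) * f x \<partial>lborel)) \<longlonglongrightarrow> s * b - s * a"
  proof (intro tendsto_diff tendsto_integral_moving_interval[OF assms(1) B])
    show "filterlim (\<lambda>x. x + t) at_top at_top" for t :: real
      by (rule filterlim_tendsto_add_at_top[OF tendsto_const filterlim_ident, of t, unfolded add.commute[of t]])
    show "filterlim (\<lambda>x. x + t) at_bot at_bot" for t :: real
      unfolding filterlim_at_bot eventually_at_bot_linorder
      by (metis le_diff_eq)
    show "filterlim (\<lambda>n. - real n) at_bot sequentially"
      by (simp add: filterlim_uminus_at_top[symmetric] filterlim_real_sequentially)
  qed (use top bot \<open>0 \<le> s\<close> filterlim_real_sequentially in auto)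
  moreover have "(\<integral>x. indicator {0..s} (x - real n) * f x \<partial>lborel)
      - (\<integral>x. indicator {0..s} (x - - real n) * f x \<partial>lborel)
      = (\<integral>x. indicator {- real n..real n} x * (f (x + s) - f x) \<partial>lborel)" for n
  proof -
    have int: "integrable lborel (\<lambda>x. indicator {u..v} x * f x)" for u v
      by (rule integrable_Icc_bounded) (use B in auto)
    have *: "(\<integral>x. indicator {0..s} (x - u) * f x \<partial>lborel) = (\<integral>x. indicator {u..u + s} x * f x \<partial>lborel)" for u
      by (rule Bochner_Integration.integral_cong) (auto simp: indicator_def)
    have "(\<integral>x. indicator {- real n..real n} x * f (x + s) \<partial>lborel)
      = (\<integral>x. indicator {- real n + s..real n + s} x * f x \<partial>lborel)"
      using integral_shift[of "\<lambda>x. indicator {- real n + s..real n + s} x * f x" s]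
      by (auto simp: indicator_def)
    moreover have "integrable lborel (\<lambda>x. indicator {- real n..real n} x * f (x + s))"
      by (rule integrable_Icc_bounded) (use B in auto)
    ultimately have "(\<integral>x. indicator {- real n..real n} x * (f (x + s) - f x) \<partial>lborel)
      = (\<integral>x. indicator {- real n + s..real n + s} x * f x \<partial>lborel) - (\<integral>x. indicator {- real n..real n} x * f x \<partial>lborel)"
      using int by (simp add: right_diff_distrib)
    also have "\<dots> = (\<integral>x. indicator {- real n + s..real n + s} x * f x - indicator {- real n..real n} x * f x \<partial>lborel)"
      using int by simp
    also have "\<dots> = (\<integral>x. indicator {real n..real n + s} x * f x - indicator {- real n..- real n + s} x * f x \<partial>lborel)"
    proof (rule integral_cong_AE)
      \<comment> \<open>Both \<open>{-n..-n+s}\<close>, \<open>{-n+s..n+s}\<close> and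
        \<open>{-n..n}\<close>, \<open>{n..n+s}\<close> tile \<open>{-n..n+s}\<close>; they count
        doubly only the points where their pieces abut.\<close>
      have "AE x in lborel. x \<noteq> real n \<and> x \<noteq> - real n + s"
        using AE_lborel_singleton by auto
      then show "AE x in lborel. indicator {- real n + s..real n + s} x * f x - indicator {- real n..real n} x * f x
        = indicator {real n..real n + s} x * f x - indicator {- real n..- real n + s} x * f x"
        by eventually_elim (use \<open>0 \<le> s\<close> in \<open>auto simp: indicator_def\<close>)
    qed auto
    also have "\<dots> = (\<integral>x. indicator {0..s} (x - real n) * f x \<partial>lborel)
      - (\<integral>x. indicator {0..s} (x - - real n) * f x \<partial>lborel)"
      unfolding * using int by simp
    finally show ?thesis by simp
  qed
  ultimately show ?thesis by (simp add: right_diff_distrib)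
qed

lemma integral_increment_eq_0:
  fixes f :: "real \<Rightarrow> real"
  assumes [measurable]: "f \<in> borel_measurable borel" and B: "\<And>x. \<bar>f x\<bar> \<le> B"
    and top: "(f \<longlongrightarrow> l) at_top" and bot: "(f \<longlongrightarrow> l) at_bot" and "0 \<le> s"
    and G: "integrable lborel G" "\<And>x. \<bar>f (x + s) - f x\<bar> \<le> G x"
  shows "(\<integral>x. f (x + s) - f x \<partial>lborel) = 0"
proof -
  have "(\<lambda>n. \<integral>x. indicator {- real n..real n} x * (f (x + s) - f x) \<partial>lborel)
    \<longlonglongrightarrow> (\<integral>x. f (x + s) - f x \<partial>lborel)"
  proof (rule integral_dominated_convergence[OF _ _ G(1)])
    show "AE x in lborel. (\<lambda>n. indicator {- real n..real n} x * (f (x + s) - f x)) \<longlonglongrightarrow> f (x + s) - f x"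
    proof (rule AE_I2, rule tendsto_eventually)
      fix x
      obtain N :: nat where "\<bar>x\<bar> \<le> real N" using real_arch_simple by blast
      then have "indicator {- real n..real n} x * (f (x + s) - f x) = f (x + s) - f x" if "N \<le> n" for n
        using that by (auto simp: indicator_def)
      then show "\<forall>\<^sub>F n in sequentially. indicator {- real n..real n} x * (f (x + s) - f x) = f (x + s) - f x"
        by (rule eventually_sequentiallyI)
    qed
    show "AE x in lborel. norm (indicator {- real n..real n} x * (f (x + s) - f x)) \<le> G x" for n
      using G(2) by (intro AE_I2) (auto simp: indicator_def intro: order_trans[OF abs_ge_zero G(2)])
  qed auto
  moreover have "(\<lambda>n. \<integral>x. indicator {- real n..real n} x * (f (x + s) - f x) \<partial>lborel) \<longlonglongrightarrow> s * (l - l)"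
    by (rule tendsto_integral_increment[OF assms(1) B top bot \<open>0 \<le> s\<close>])
  ultimately have "(\<integral>x. f (x + s) - f x \<partial>lborel) = s * (l - l)"
    by (rule LIMSEQ_unique)
  then show ?thesis by simp
qed

text \<open>\<open>opA f x - f x\<close> is the mean of the increments
  \<open>f (x + s) - f x\<close> over the window. Each increment integrates to 0 because
  \<open>f\<close> has equal limits at both ends, and the majorant \<open>G\<close>, uniform in
  \<open>s\<close>, justifies exchanging the integrals.\<close>

lemma
  fixes f :: "real \<Rightarrow> real"
  assumes f: "f \<in> borel_measurable borel" and B: "\<And>x. \<bar>f x\<bar> \<le> B"
    and top: "(f \<longlongrightarrow> l) at_top" and bot: "(f \<longlongrightarrow> l) at_bot"
    and G: "integrable lborel G" "\<And>x s. \<bar>s\<bar> \<le> 1/2 \<Longrightarrow> \<bar>f (x + s) - f x\<bar> \<le> G x"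
  shows integrable_opA_minus_self: "integrable lborel (\<lambda>x. opA f x - f x)"
    and integral_opA_minus_self: "(\<integral>x. opA f x - f x \<partial>lborel) = 0"
proof -
  note [measurable] = f
  have G0: "0 \<le> G x" for x
    using G(2)[of 0 x] by simp
  have eq: "opA f x - f x = (\<integral>s. f (x + s) - f x \<partial>unit_window)" for x
      proof -
    have "(\<integral>s. f (x + s) - f x \<partial>unit_window) = (\<integral>s. f (x + s) \<partial>unit_window) - (\<integral>s. f x \<partial>unit_window)"
      by (rule Bochner_Integration.integral_diff[OF integrable_window[OF f B]]) (rule window.integrable_const)
    moreover have "(\<integral>s. f x \<partial>unit_window) = f x"
      by (subst lebesgue_integral_const, subst window.prob_space) (rule scaleR_one)
    ultimately show ?thesis by (simp only: opA_window[OF f])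
  qed
  have [measurable]: "G \<in> borel_measurable borel" using G(1) by auto
  have abs: "\<bar>opA f x - f x\<bar> \<le> G x" for x
  proof -
    have near: "\<bar>f y - f x\<bar> \<le> G x" if "x - 1/2 \<le> y" "y \<le> x + 1/2" for y
    proof -
      have "\<bar>y - x\<bar> \<le> 1/2" using that by linarith
      from G(2)[OF this, of x] show ?thesis by simp
    qed
    have "opA f x \<le> f x + G x"
      by (rule opA_le[OF f B]) (use near in \<open>fastforce simp: abs_le_iff\<close>)
    moreover have "f x - G x \<le> opA f x"
      by (rule opA_ge[OF f B]) (use near in \<open>fastforce simp: abs_le_iff\<close>)
    ultimately show ?thesis by linarith
  qed
  show "integrable lborel (\<lambda>x. opA f x - f x)"
    by (rule Bochner_Integration.integrable_bound[OF G(1)]) (use abs G0 in auto)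
  have zero: "(\<integral>x. f (x + s) - f x \<partial>lborel) = 0" if s: "\<bar>s\<bar> \<le> 1/2" for s
  proof (cases "0 \<le> s")
    case True
    show ?thesis
      by (rule integral_increment_eq_0[OF f B top bot True G(1)]) (use G(2) s in auto)
  next
    case False
    \<comment> \<open>Translating by \<open>- s\<close> turns a negative increment into minus a
      positive one.\<close>
    have "(\<integral>x. f (x + s) - f x \<partial>lborel) = (\<integral>x. f (x + - s + s) - f (x + - s) \<partial>lborel)"
      using integral_shift[of "\<lambda>x. f (x + s) - f x" "- s"] by simp
    also have "\<dots> = - (\<integral>x. f (x + - s) - f x \<partial>lborel)"
      by (subst Bochner_Integration.integral_minus[symmetric]) simp
    also have "\<dots> = - 0"
      using integral_increment_eq_0[OF f B top bot _ G(1), of "- s"] G(2)[of "- s"] s False by simp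
    finally show ?thesis by simp
  qed
  have meas: "(\<lambda>(x, s). f (x + s)) \<in> borel_measurable (lborel \<Otimes>\<^sub>M unit_window)"
    by (rule borel_measurable_pair_window[OF f]) simp
  have "integrable (lborel \<Otimes>\<^sub>M unit_window) (\<lambda>(x, s). f (x + s) - f x)"
  proof (rule lborel_window.Fubini_integrable)
    have "(\<lambda>p. f (fst p)) \<in> borel_measurable (lborel \<Otimes>\<^sub>M unit_window)"
      by (rule measurable_compose[OF measurable_fst]) simp
    with meas show m: "(\<lambda>(x, s). f (x + s) - f x) \<in> borel_measurable (lborel \<Otimes>\<^sub>M unit_window)"
      unfolding case_prod_beta by simp
    have int: "integrable unit_window (\<lambda>s. f (x + s) - f x)" for x
      using integrable_window[OF f B] by auto
    then show "AE x in lborel. integrable unit_window (\<lambda>s. case (x, s) of (x, s) \<Rightarrow> f (x + s) - f x)"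
      by simp
    show "integrable lborel (\<lambda>x. \<integral>s. norm (case (x, s) of (x, s) \<Rightarrow> f (x + s) - f x) \<partial>unit_window)"
    proof (rule Bochner_Integration.integrable_bound[OF G(1)])
      have "(\<lambda>p. norm ((\<lambda>(x, s). f (x + s) - f x) p)) \<in> borel_measurable (lborel \<Otimes>\<^sub>M unit_window)"
        using m by measurable
      then show "(\<lambda>x. \<integral>s. norm (case (x, s) of (x, s) \<Rightarrow> f (x + s) - f x) \<partial>unit_window) \<in> borel_measurable lborel"
        by (intro window.borel_measurable_lebesgue_integral) (simp add: case_prod_beta)
      have "(\<integral>s. norm (f (x + s) - f x) \<partial>unit_window) \<le> G x" for x
      proof (rule window.integral_le_const[OF integrable_norm[OF int]], rule AE_I2)
        fix s assume "s \<in> space unit_window"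
        then have "\<bar>s\<bar> \<le> 1/2" by auto
        then show "norm (f (x + s) - f x) \<le> G x" using G(2) by simp
      qed
      then show "AE x in lborel. norm (\<integral>s. norm (case (x, s) of (x, s) \<Rightarrow> f (x + s) - f x) \<partial>unit_window) \<le> norm (G x)"
        by (intro AE_I2) (auto simp: abs_of_nonneg G0)
    qed
  qed
  from lborel_window.Fubini_integral[OF this]
  have "(\<integral>x. opA f x - f x \<partial>lborel) = (\<integral>s. \<integral>x. f (x + s) - f x \<partial>lborel \<partial>unit_window)"
    by (simp add: eq)
  also have "\<dots> = (\<integral>s. 0 \<partial>unit_window)"
    by (rule Bochner_Integration.integral_cong) (use zero in auto)
  finally show "(\<integral>x. opA f x - f x \<partial>lborel) = 0" by simp
qed

section \<open>Monotone profiles and the energy density\<close>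

definition front :: "(real \<Rightarrow> real) \<Rightarrow> bool" where
  "front V \<longleftrightarrow> mono V \<and> (V \<longlongrightarrow> 1) at_top \<and> (V \<longlongrightarrow> -1) at_bot"

text \<open>What survives in Helly's theorem: limits of fronts remain monotone and bounded by 1, but
  the limits at infinity may be lost. They are recovered separately in
  \<open>front_of_profile\<close>.\<close>

definition profile :: "(real \<Rightarrow> real) \<Rightarrow> bool" where
  "profile V \<longleftrightarrow> mono V \<and> (\<forall>x. \<bar>V x\<bar> \<le> 1)"

lemma profile_abs_le: "profile V \<Longrightarrow> \<bar>V x\<bar> \<le> 1"
  and profile_mono: "profile V \<Longrightarrow> x \<le> y \<Longrightarrow> V x \<le> V y"
  by (auto simp: profile_def monoD)

lemma profile_measurable [measurable_dest]: "profile V \<Longrightarrow> V \<in> borel_measurable borel"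
  by (simp add: profile_def borel_measurable_mono)

lemma front_imp_profile:
  assumes "front V" shows "profile V"
proof -
  have m: "V x \<le> V y" if "x \<le> y" for x y
    using assms that by (auto simp: front_def monoD)
  have "V x \<le> 1" for x
  proof (rule tendsto_lowerbound[where F = at_top])
    show "\<forall>\<^sub>F y in at_top. V x \<le> V y"
      unfolding eventually_at_top_linorder using m by auto
  qed (use assms in \<open>auto simp: front_def\<close>)
  moreover have "-1 \<le> V x" for x
  proof (rule tendsto_upperbound[where F = at_bot])
    show "\<forall>\<^sub>F y in at_bot. V y \<le> V x"
      unfolding eventually_at_bot_linorder using m by auto
  qed (use assms in \<open>auto simp: front_def\<close>)
  ultimately show ?thesis
    using assms by (auto simp: front_def profile_def abs_le_iff minus_le_iff)
qed

lemma profile_opA_bounds: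
  assumes "profile V"
  shows "V (x - 1/2) \<le> opA V x" "opA V x \<le> V (x + 1/2)" "\<bar>opA V x\<bar> \<le> 1"
proof -
  note V = profile_measurable[OF assms] profile_abs_le[OF assms]
  show *: "V (x - 1/2) \<le> opA V x" "opA V x \<le> V (x + 1/2)"
    by (rule opA_ge[OF V] opA_le[OF V]; rule profile_mono[OF assms]; simp)+
  show "\<bar>opA V x\<bar> \<le> 1"
    using * V(2)[of "x - 1/2"] V(2)[of "x + 1/2"] by linarith
qed

text \<open>The unit increment of a front is nonnegative and its truncated integrals telescope to
  \<open>1 - (-1) = 2\<close>, so monotone convergence gives integrability with no decay assumption.
  This is the universal majorant for the error terms below.\<close>

lemma integrable_front_increment:
  assumes "front V"
  shows "integrable lborel (\<lambda>x. V (x + 1/2) - V (x - 1/2))"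
proof -
  note V = front_imp_profile[OF assms]
  note [measurable] = profile_measurable[OF V]
  note mono = profile_mono[OF V]
  have "integrable lborel (\<lambda>x. V (x + 1) - V x)"
  proof (rule integrable_monotone_convergence)
    show "integrable lborel (\<lambda>x. indicator {- real n..real n} x * (V (x + 1) - V x))" for n
      by (rule integrable_Icc_bounded[where B = 2])
         (use profile_abs_le[OF V] in \<open>auto intro: abs_triangle_ineq4[THEN order_trans] add_mono[of _ "1::real" _ 1, simplified]\<close>)
    show "AE x in lborel. incseq (\<lambda>n. indicator {- real n..real n} x * (V (x + 1) - V x))"
      by (intro AE_I2 incseq_SucI) (auto simp: indicator_def mono)
    show "(\<lambda>n. \<integral>x. indicator {- real n..real n} x * (V (x + 1) - V x) \<partial>lborel) \<longlonglongrightarrow> 1 * (1 - - 1)"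
      by (rule tendsto_integral_increment[where B = 1]) (use assms profile_abs_le[OF V] in \<open>auto simp: front_def\<close>)
    show "AE x in lborel. (\<lambda>n. indicator {- real n..real n} x * (V (x + 1) - V x)) \<longlonglongrightarrow> V (x + 1) - V x"
    proof (rule AE_I2, rule tendsto_eventually)
      fix x
      obtain N :: nat where "\<bar>x\<bar> \<le> real N" using real_arch_simple by blast
      then have "indicator {- real n..real n} x * (V (x + 1) - V x) = V (x + 1) - V x" if "N \<le> n" for n
        using that by (auto simp: indicator_def)
      then show "\<forall>\<^sub>F n in sequentially. indicator {- real n..real n} x * (V (x + 1) - V x) = V (x + 1) - V x"
        by (rule eventually_sequentiallyI)
    qed
  qed auto
  moreover have "x + - (1/2) + 1 = x + 1/2" for x :: real by simp
  ultimately show ?thesis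
    using integrable_shift[of "\<lambda>x. V (x + 1) - V x" "- (1/2)"] by (simp only: diff_conv_add_uminus)
qed

text \<open>Squaring equalises the limits at the two ends, so the telescoped integral vanishes. The
  majorant comes from factoring a difference of squares, with the sum bounded by 2 and the
  difference by the front's increment.\<close>

lemma front_square_opA_minus_self:
  assumes "front V"
  shows "integrable lborel (\<lambda>x. opA (\<lambda>x. (V x)\<^sup>2) x - (V x)\<^sup>2)"
    and "(\<integral>x. opA (\<lambda>x. (V x)\<^sup>2) x - (V x)\<^sup>2 \<partial>lborel) = 0"
proof -
  note V = front_imp_profile[OF assms]
  note [measurable] = profile_measurable[OF V]
  have "((\<lambda>x. (V x)\<^sup>2) \<longlongrightarrow> 1) at_top" "((\<lambda>x. (V x)\<^sup>2) \<longlongrightarrow> 1) at_bot"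
    using tendsto_power[of V 1 at_top 2] tendsto_power[of V "-1" at_bot 2] assms[unfolded front_def]
    by (simp_all only: power2_minus power_one)
  moreover have "\<bar>(V x)\<^sup>2\<bar> \<le> 1" for x
    using profile_abs_le[OF V, of x] by (simp add: abs_square_le_1)
  moreover have "\<bar>(V (x + s))\<^sup>2 - (V x)\<^sup>2\<bar> \<le> 2 * (V (x + 1/2) - V (x - 1/2))" if "\<bar>s\<bar> \<le> 1/2" for x s
  proof -
    have "\<bar>(V (x + s))\<^sup>2 - (V x)\<^sup>2\<bar> = \<bar>V (x + s) + V x\<bar> * \<bar>V (x + s) - V x\<bar>"
      by (simp add: abs_mult[symmetric] power2_eq_square algebra_simps)
    also have "\<dots> \<le> 2 * (V (x + 1/2) - V (x - 1/2))"
    proof (rule mult_mono)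
      show "\<bar>V (x + s) + V x\<bar> \<le> 2"
        using profile_abs_le[OF V, of x] profile_abs_le[OF V, of "x + s"] by linarith
      have "V (x - 1/2) \<le> V (x + s)" "V (x + s) \<le> V (x + 1/2)" "V (x - 1/2) \<le> V x" "V x \<le> V (x + 1/2)"
        using that by (auto intro!: profile_mono[OF V])
      then show "\<bar>V (x + s) - V x\<bar> \<le> V (x + 1/2) - V (x - 1/2)" by linarith
    qed auto
    finally show ?thesis .
  qed
  moreover have "integrable lborel (\<lambda>x. 2 * (V (x + 1/2) - V (x - 1/2)))"
    using integrable_front_increment[OF assms] by (rule integrable_mult_right)
  moreover have "(\<lambda>x. (V x)\<^sup>2) \<in> borel_measurable borel" by measurable
  ultimately show "integrable lborel (\<lambda>x. opA (\<lambda>x. (V x)\<^sup>2) x - (V x)\<^sup>2)"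
    and "(\<integral>x. opA (\<lambda>x. (V x)\<^sup>2) x - (V x)\<^sup>2 \<partial>lborel) = 0"
    using integrable_opA_minus_self[of "\<lambda>x. (V x)\<^sup>2" 1 1 "\<lambda>x. 2 * (V (x + 1/2) - V (x - 1/2))"]
      integral_opA_minus_self[of "\<lambda>x. (V x)\<^sup>2" 1 1 "\<lambda>x. 2 * (V (x + 1/2) - V (x - 1/2))"] by blast+
qed

lemma front_Wsh: "front Wsh"
proof -
  have "mono Wsh" by (auto simp: mono_def Wsh_def sgn_if)
  moreover have "(Wsh \<longlongrightarrow> 1) at_top"
    by (rule tendsto_eventually) (auto simp: Wsh_def sgn_if intro: eventually_at_top_linorderI[of 1])
  moreover have "(Wsh \<longlongrightarrow> -1) at_bot"
  proof (rule tendsto_eventually)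
    have "Wsh x = -1" if "x \<le> -1" for x using that by (simp add: Wsh_def sgn_if)
    then show "\<forall>\<^sub>F x in at_bot. Wsh x = - 1" by (auto simp: eventually_at_bot_linorder)
  qed
  ultimately show ?thesis by (simp add: front_def)
qed

section \<open>Centred profiles and the energy density of a double well\<close>

lemma Wsh_simps [simp]: "0 < x \<Longrightarrow> Wsh x = 1" "x < 0 \<Longrightarrow> Wsh x = -1" "Wsh 0 = 0"
  by (auto simp: Wsh_def)

text \<open>The value at 0 stays free: the sign conditions of \<open>C0set\<close> hold only almost
  everywhere and determine nothing at a single point.\<close>

definition centred :: "(real \<Rightarrow> real) \<Rightarrow> bool" where
  "centred V \<longleftrightarrow> (\<forall>x>0. 0 \<le> V x) \<and> (\<forall>x<0. V x \<le> 0)"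

text \<open>The lower bound provides coercivity, the upper bound makes \<open>g (opA V)\<close>
  integrable for fronts at finite \<open>L2\<close> distance from \<open>Wsh\<close>.\<close>

locale double_well =
  fixes g :: "real \<Rightarrow> real" and c C :: real
  assumes continuous_g: "continuous_on UNIV g"
    and c_pos: "0 < c"
    and g_lower: "\<bar>w\<bar> \<le> 1 \<Longrightarrow> c * (1 - \<bar>w\<bar>)\<^sup>2 \<le> g w"
    and g_upper: "\<bar>w\<bar> \<le> 1 \<Longrightarrow> g w \<le> C * (1 - \<bar>w\<bar>)\<^sup>2"
begin

lemma g_measurable [measurable]: "g \<in> borel_measurable borel"
  using continuous_g by (rule borel_measurable_continuous_onI)

lemma C_pos: "0 < C"
  using g_lower[of 0] g_upper[of 0] c_pos by simp

text \<open>The first summand is half the variance of \<open>V\<close> over the window around \<open>\<phi>\<close>, hence nonnegative.\<close>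

definition dens :: "(real \<Rightarrow> real) \<Rightarrow> real \<Rightarrow> real" where
  "dens V \<phi> = (opA (\<lambda>x. (V x)\<^sup>2) \<phi> - (opA V \<phi>)\<^sup>2) / 2 + g (opA V \<phi>)"

lemma dens_measurable [measurable]:
  assumes [measurable]: "V \<in> borel_measurable borel"
  shows "dens V \<in> borel_measurable borel"
  unfolding dens_def by measurable

lemma dens_ge:
  assumes "profile V"
  shows "c * (1 - \<bar>opA V \<phi>\<bar>)\<^sup>2 \<le> dens V \<phi>"
proof -
  have "(opA V \<phi>)\<^sup>2 \<le> opA (\<lambda>x. (V x)\<^sup>2) \<phi>"
    by (rule opA_square_le[OF profile_measurable[OF assms] profile_abs_le[OF assms]])
  moreover have "c * (1 - \<bar>opA V \<phi>\<bar>)\<^sup>2 \<le> g (opA V \<phi>)"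
    by (rule g_lower[OF profile_opA_bounds(3)[OF assms]])
  ultimately show ?thesis unfolding dens_def by (intro add_increasing) auto
qed

lemma dens_nonneg: "profile V \<Longrightarrow> 0 \<le> dens V \<phi>"
  by (rule order_trans[OF _ dens_ge]) (use c_pos in auto)

lemma dens_shift:
  assumes "V \<in> borel_measurable borel"
  shows "dens (\<lambda>x. V (x + a)) \<phi> = dens V (\<phi> + a)"
proof -
  have "(\<lambda>x. (V x)\<^sup>2) \<in> borel_measurable borel" using assms by measurable
  from opA_shift[OF this] opA_shift[OF assms] show ?thesis by (simp add: dens_def)
qed

lemma dens_tendsto:
  assumes V: "\<And>n. profile (V n)" and V': "profile V'" and lim: "AE x in lborel. (\<lambda>n. V n x) \<longlonglongrightarrow> V' x"
  shows "(\<lambda>n. dens (V n) \<phi>) \<longlonglongrightarrow> dens V' \<phi>"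
proof -
  note [measurable] = profile_measurable[OF V] profile_measurable[OF V']
  have 1: "(\<lambda>n. opA (V n) \<phi>) \<longlonglongrightarrow> opA V' \<phi>"
    by (rule opA_tendsto[where B = 1]) (use lim profile_abs_le[OF V] in auto)
  have 2: "(\<lambda>n. opA (\<lambda>x. (V n x)\<^sup>2) \<phi>) \<longlonglongrightarrow> opA (\<lambda>x. (V' x)\<^sup>2) \<phi>"
  proof (rule opA_tendsto[where B = 1])
    show "AE x in lborel. (\<lambda>n. (V n x)\<^sup>2) \<longlonglongrightarrow> (V' x)\<^sup>2"
      using lim by eventually_elim (rule tendsto_power)
    show "\<bar>(V n x)\<^sup>2\<bar> \<le> 1" for n x
      using profile_abs_le[OF V, of n x] by (simp add: abs_square_le_1)
  qed auto
  have 3: "(\<lambda>n. g (opA (V n) \<phi>)) \<longlonglongrightarrow> g (opA V' \<phi>)"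
    using continuous_on_tendsto_compose[OF continuous_g 1] by simp
  show ?thesis unfolding dens_def by (intro tendsto_intros 1 2 3) simp
qed

text \<open>If the window lies to the right of 0, then \<open>V (x - 1/2) \<le> opA V x\<close>, so
  the distance of the average from the well is at most that of \<open>V\<close> at the left end;
  symmetrically on the left. Windows meeting 0 are covered by the indicator.\<close>

lemma g_opA_le:
  assumes V: "profile V"
  shows "g (opA V x) \<le> C * ((Wsh (x - 1/2) - V (x - 1/2))\<^sup>2 + (Wsh (x + 1/2) - V (x + 1/2))\<^sup>2
    + indicator {-1/2..1/2} x)"
proof -
  note b = profile_opA_bounds[OF V, of x]
  have "(1 - \<bar>opA V x\<bar>)\<^sup>2 \<le> (Wsh (x - 1/2) - V (x - 1/2))\<^sup>2 + (Wsh (x + 1/2) - V (x + 1/2))\<^sup>2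
    + indicator {-1/2..1/2} x"
  proof -
    consider "1/2 < x" | "x < -1/2" | "x \<in> {-1/2..1/2}" by fastforce
    then show ?thesis
    proof cases
      case 1
      then have "(1 - \<bar>opA V x\<bar>)\<^sup>2 \<le> (Wsh (x - 1/2) - V (x - 1/2))\<^sup>2"
        using b by (intro power_mono) auto
      then show ?thesis by (simp add: add_increasing2)
    next
      case 2
      then have "(1 - \<bar>opA V x\<bar>)\<^sup>2 \<le> (V (x + 1/2) - Wsh (x + 1/2))\<^sup>2"
        using b by (intro power_mono) auto
      then show ?thesis by (simp add: add_increasing2 add_increasing power2_commute)
    next
      case 3
      have "(1 - \<bar>opA V x\<bar>)\<^sup>2 \<le> 1\<^sup>2"
        using b by (intro power_mono) auto
      with 3 show ?thesis by (simp add: add_increasing)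
    qed
  qed
  then have "C * (1 - \<bar>opA V x\<bar>)\<^sup>2 \<le> C * ((Wsh (x - 1/2) - V (x - 1/2))\<^sup>2
      + (Wsh (x + 1/2) - V (x + 1/2))\<^sup>2 + indicator {-1/2..1/2} x)"
    using C_pos by (intro mult_left_mono) auto
  with g_upper[OF b(3)] show ?thesis by (rule order_trans)
qed

text \<open>The difference of squares is integrable by monotonicity alone; only
  \<open>g (opA V)\<close> uses the \<open>L2\<close> hypothesis. The Lagrangian integrand and
  \<open>dens V\<close> differ by half of \<open>opA (V\<^sup>2) - V\<^sup>2\<close>, whose integral
  is 0.\<close>

lemma
  assumes front: "front V" and L2: "integrable lborel (\<lambda>x. (Wsh x - V x)\<^sup>2)"
  shows integrable_dens: "integrable lborel (dens V)"
    and integrable_lagrangian: "integrable lborel (\<lambda>x. (V x)\<^sup>2 / 2 - (opA V x)\<^sup>2 / 2 + g (opA V x))" (is "integrable _ ?l")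
    and integral_lagrangian: "(\<integral>x. (V x)\<^sup>2 / 2 - (opA V x)\<^sup>2 / 2 + g (opA V x) \<partial>lborel) = (\<integral>x. dens V x \<partial>lborel)"
proof -
  note V = front_imp_profile[OF front]
  note [measurable] = profile_measurable[OF V]
  have [measurable]: "Wsh \<in> borel_measurable borel"
    by (rule profile_measurable[OF front_imp_profile[OF front_Wsh]])
  note b = profile_opA_bounds[OF V]
  have 1: "integrable lborel (\<lambda>x. (V x)\<^sup>2 - (opA V x)\<^sup>2)"
  proof (rule integrable_abs_le[OF integrable_mult_right[OF integrable_front_increment[OF front], of 2]])
    show "\<bar>(V x)\<^sup>2 - (opA V x)\<^sup>2\<bar> \<le> 2 * (V (x + 1/2) - V (x - 1/2))" for x
    proof -
      have "\<bar>(V x)\<^sup>2 - (opA V x)\<^sup>2\<bar> = \<bar>V x + opA V x\<bar> * \<bar>V x - opA V x\<bar>"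
        by (simp add: abs_mult[symmetric] power2_eq_square algebra_simps)
      also have "\<dots> \<le> 2 * (V (x + 1/2) - V (x - 1/2))"
      proof (rule mult_mono)
        show "\<bar>V x + opA V x\<bar> \<le> 2"
          using profile_abs_le[OF V, of x] b(3)[of x] by linarith
        have "V (x - 1/2) \<le> V x" "V x \<le> V (x + 1/2)"
          by (auto intro!: profile_mono[OF V])
        then show "\<bar>V x - opA V x\<bar> \<le> V (x + 1/2) - V (x - 1/2)" using b[of x] by linarith
      qed auto
      finally show ?thesis .
    qed
  qed auto
  have 2: "integrable lborel (\<lambda>x. g (opA V x))"
  proof (rule integrable_abs_le)
    have "integrable lborel (\<lambda>x. (Wsh (x + a) - V (x + a))\<^sup>2)" for a
      by (rule integrable_shift[OF L2])
    from this[of "1/2"] this[of "-1/2"]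
    show "integrable lborel (\<lambda>x. C * ((Wsh (x - 1/2) - V (x - 1/2))\<^sup>2 + (Wsh (x + 1/2) - V (x + 1/2))\<^sup>2
      + indicator {-1/2..1/2} x))"
      by (intro integrable_mult_right Bochner_Integration.integrable_add)
         (simp_all add: integrable_indicator_iff emeasure_lborel_Icc_eq)
    have "0 \<le> g (opA V x)" for x
      by (rule order_trans[OF _ g_lower[OF b(3)]]) (use c_pos in auto)
    with g_opA_le[OF V] show "\<bar>g (opA V x)\<bar> \<le> C * ((Wsh (x - 1/2) - V (x - 1/2))\<^sup>2
      + (Wsh (x + 1/2) - V (x + 1/2))\<^sup>2 + indicator {-1/2..1/2} x)" for x
      by (simp only: abs_of_nonneg)
  qed auto
  note 3 = front_square_opA_minus_self[OF front]
  have l: "?l = (\<lambda>x. ((V x)\<^sup>2 - (opA V x)\<^sup>2) / 2 + g (opA V x))"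
    by (simp add: diff_divide_distrib)
  have d: "dens V = (\<lambda>x. ?l x + (opA (\<lambda>x. (V x)\<^sup>2) x - (V x)\<^sup>2) / 2)"
    by (rule ext) (simp add: dens_def diff_divide_distrib)
  show int: "integrable lborel ?l"
    unfolding l by (intro Bochner_Integration.integrable_add integrable_divide 1 2)
  have half: "integrable lborel (\<lambda>x. (opA (\<lambda>x. (V x)\<^sup>2) x - (V x)\<^sup>2) / 2)"
    by (rule integrable_divide[OF 3(1)])
  show "integrable lborel (dens V)"
    unfolding d by (rule Bochner_Integration.integrable_add[OF int half])
  have "(\<integral>x. dens V x \<partial>lborel) = (\<integral>x. ?l x \<partial>lborel) + (\<integral>x. (opA (\<lambda>x. (V x)\<^sup>2) x - (V x)\<^sup>2) / 2 \<partial>lborel)"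
    unfolding d by (rule Bochner_Integration.integral_add[OF int half])
  with 3(2) show "(\<integral>x. ?l x \<partial>lborel) = (\<integral>x. dens V x \<partial>lborel)" by simp
qed

lemma distance_le_dens:
  assumes V: "profile V" and "centred V"
  shows "(Wsh x - V x)\<^sup>2 \<le> (dens V (x - 1/2) + dens V (x + 1/2)) / c + indicator {-1..1} x"
proof -
  have *: "(1 - \<bar>opA V y\<bar>)\<^sup>2 \<le> dens V y / c" for y
    using dens_ge[OF V, of y] c_pos by (simp add: field_simps)
  have nn: "0 \<le> dens V y / c" for y
    using dens_nonneg[OF V] c_pos by simp
  have ind: "0 \<le> (indicator {-1..1} x :: real)" by simp
  note b = profile_opA_bounds[OF V]
  have sq: "(Wsh x - V x)\<^sup>2 \<le> dens V (x - 1/2) / c + dens V (x + 1/2) / c + indicator {-1..1} x"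
  proof -
    consider "1 < x" | "x < -1" | "x \<in> {-1..1}" by fastforce
    then show ?thesis
    proof cases
      case 1
      have "0 \<le> V (x - 1)" using 1 \<open>centred V\<close> by (simp add: centred_def)
      then have "0 \<le> opA V (x - 1/2)" "opA V (x - 1/2) \<le> V x" using b[of "x - 1/2"] by auto
      then have "(Wsh x - V x)\<^sup>2 \<le> (1 - \<bar>opA V (x - 1/2)\<bar>)\<^sup>2"
        using 1 profile_abs_le[OF V, of x] by (intro power_mono) auto
      from order_trans[OF this *] nn[of "x + 1/2"] ind show ?thesis by linarith
    next
      case 2
      have "V (x + 1) \<le> 0" using 2 \<open>centred V\<close> by (simp add: centred_def)
      then have "opA V (x + 1/2) \<le> 0" "V x \<le> opA V (x + 1/2)" using b[of "x + 1/2"] by (auto simp: add.commute)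
      then have "(V x - Wsh x)\<^sup>2 \<le> (1 - \<bar>opA V (x + 1/2)\<bar>)\<^sup>2"
        using 2 profile_abs_le[OF V, of x] by (intro power_mono) auto
      from order_trans[OF this *] nn[of "x - 1/2"] ind show ?thesis
        unfolding power2_commute[of "V x"] by linarith
    next
      case 3
      \<comment> \<open>\<open>V\<close> and \<open>Wsh\<close> have the same sign off 0, and
        \<open>Wsh 0 = 0\<close>.\<close>
      have "\<bar>Wsh x - V x\<bar> \<le> 1"
        using \<open>centred V\<close> profile_abs_le[OF V, of x]
        by (cases x "0::real" rule: linorder_cases) (auto simp: centred_def)
      with 3 nn[of "x - 1/2"] nn[of "x + 1/2"] show ?thesis
        unfolding abs_square_le_1[symmetric] by simp
    qed
  qed
  then show ?thesis by (simp add: add_divide_distrib)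
qed

lemma integrable_distance_bound:
  assumes "integrable lborel (dens V)"
  shows "integrable lborel (\<lambda>x. (dens V (x - 1/2) + dens V (x + 1/2)) / c + indicator {-1..1} x)"
    and "(\<integral>x. (dens V (x - 1/2) + dens V (x + 1/2)) / c + indicator {-1..1} x \<partial>lborel)
      = 2 * (\<integral>x. dens V x \<partial>lborel) / c + 2"
proof -
  have 1: "integrable lborel (\<lambda>x. dens V (x - 1/2))" "integrable lborel (\<lambda>x. dens V (x + 1/2))"
    using integrable_shift[OF assms, of "-1/2"] integrable_shift[OF assms, of "1/2"] by simp_all
  have 2: "(\<integral>x. dens V (x - 1/2) \<partial>lborel) = (\<integral>x. dens V x \<partial>lborel)"
    "(\<integral>x. dens V (x + 1/2) \<partial>lborel) = (\<integral>x. dens V x \<partial>lborel)"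
    using integral_shift[of "dens V" "-1/2"] integral_shift[of "dens V" "1/2"] by simp_all
  have 3: "integrable lborel (indicator {-1..1} :: real \<Rightarrow> real)"
    by (simp add: integrable_indicator_iff emeasure_lborel_Icc_eq)
  show "integrable lborel (\<lambda>x. (dens V (x - 1/2) + dens V (x + 1/2)) / c + indicator {-1..1} x)"
    using 1 3 by simp
  show "(\<integral>x. (dens V (x - 1/2) + dens V (x + 1/2)) / c + indicator {-1..1} x \<partial>lborel)
      = 2 * (\<integral>x. dens V x \<partial>lborel) / c + 2"
    using 1 2 3 by simp
qed

lemma integrable_distance:
  assumes V: "profile V" and "centred V" "integrable lborel (dens V)"
  shows "integrable lborel (\<lambda>x. (Wsh x - V x)\<^sup>2)"
proof (rule integrable_abs_le[OF integrable_distance_bound(1)[OF assms(3)]])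
  note [measurable] = profile_measurable[OF V] profile_measurable[OF front_imp_profile[OF front_Wsh]]
  show "(\<lambda>x. (Wsh x - V x)\<^sup>2) \<in> borel_measurable lborel" by measurable
qed (use distance_le_dens[OF V assms(2)] in simp)

end

section \<open>Compactness of monotone profiles\<close>

lemma AE_lborel_imp_ex_between:
  fixes a b :: real
  assumes "AE x in lborel. P x" "a < b"
  shows "\<exists>x. a < x \<and> x < b \<and> P x"
proof (rule ccontr)
  assume "\<not> ?thesis"
  then have "AE x in lborel. x \<notin> {a<..<b}"
    using assms(1) by (auto elim: eventually_mono)
  then have "{a<..<b} \<in> null_sets lborel"
    by (subst AE_iff_null_sets) auto
  then show False using \<open>a < b\<close> by (simp add: null_sets_def)
qed

lemma mono_AE_isCont:
  fixes F :: "real \<Rightarrow> real"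
  assumes "mono F" shows "AE x in lborel. isCont F x"
  using AE_not_in[OF countable_imp_null_set_lborel[OF mono_ctble_discont[OF assms]]] by simp

text \<open>Helly's selection theorem asks for right-continuous functions. The right limit, written
  as an infimum by monotonicity, agrees with \<open>V\<close> wherever \<open>V\<close> is
  continuous, that is, off a countable set.\<close>

lemma profile_right_continuous_version:
  assumes V: "profile V"
  obtains R where "profile R" "\<And>x. continuous (at_right x) R" "AE x in lborel. R x = V x"
proof -
  define R where "R x = (INF y\<in>{x<..}. V y)" for x
  have bdd: "bdd_below (V ` {x<..})" for x
    using profile_abs_le[OF V] by (intro bdd_belowI2[of _ "-1"]) (simp add: abs_le_iff minus_le_iff)
  have lower: "R x \<le> V y" if "x < y" for x y
    unfolding R_def by (rule cINF_lower[OF bdd]) (use that in auto)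
  have upper: "b \<le> R x" if "\<And>y. x < y \<Longrightarrow> b \<le> V y" for b x
    unfolding R_def by (rule cINF_greatest) (use that in auto)
  have le: "V x \<le> R x" for x
    by (rule upper) (rule profile_mono[OF V], simp)
  have mono: "R x \<le> R y" if "x \<le> y" for x y
    by (rule upper) (use that lower in auto)
  have "\<bar>R x\<bar> \<le> 1" for x
    using le[of x] lower[of x "x + 1"] profile_abs_le[OF V, of x] profile_abs_le[OF V, of "x + 1"] by linarith
  with mono have "profile R" by (simp add: profile_def mono_def)
  moreover have "continuous (at_right x) R" for x
  proof (subst continuous_at_right_real_increasing, rule mono, assumption, intro allI impI)
    fix e :: real assume "0 < e"
    then obtain y where y: "x < y" "V y < R x + e"
      using upper[of x "R x + e"] by force
    then have "R (x + (y - x) / 2) \<le> V y" by (intro lower) (simp add: field_simps)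
    with y show "\<exists>\<delta>>0. R (x + \<delta>) - R x < e"
      by (intro exI[of _ "(y - x) / 2"]) auto
  qed
  moreover have "AE x in lborel. R x = V x"
    using mono_AE_isCont[OF V[unfolded profile_def, THEN conjunct1]]
  proof eventually_elim
    fix x assume "isCont V x"
    then have "(V \<longlongrightarrow> V x) (at_right x)"
      by (simp add: isCont_def filterlim_at_split)
    then have "R x \<le> V x"
    proof (rule tendsto_lowerbound)
      show "\<forall>\<^sub>F y in at_right x. R x \<le> V y"
        using eventually_at_right_less[of x] by eventually_elim (rule lower)
    qed simp
    with le[of x] show "R x = V x" by simp
  qed
  ultimately show ?thesis by (rule that)
qed

text \<open>Helly's theorem gives convergence at the continuity points of the limit, and a monotone
  limit has only countably many others.\<close>

lemma profile_selection:
  assumes V: "\<And>n. profile (V n)"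
  obtains r F where "strict_mono (r :: nat \<Rightarrow> nat)" "profile F" "AE x in lborel. (\<lambda>n. V (r n) x) \<longlonglongrightarrow> F x"
proof -
  have "\<exists>R. profile R \<and> (\<forall>x. continuous (at_right x) R) \<and> (AE x in lborel. R x = V n x)" for n
    using profile_right_continuous_version[OF V] by metis
  then obtain R where R: "\<And>n. profile (R n)" "\<And>n x. continuous (at_right x) (R n)"
    "\<And>n. AE x in lborel. R n x = V n x" by metis
  obtain r F where "strict_mono r" and F: "mono F" "\<And>x. \<bar>F x\<bar> \<le> 1"
    and lim: "\<And>x. isCont F x \<Longrightarrow> (\<lambda>n. R (r n) x) \<longlonglongrightarrow> F x"
    using Helly_selection[of R 1] R(1,2) unfolding profile_def by blast
  moreover have "AE x in lborel. (\<lambda>n. V (r n) x) \<longlonglongrightarrow> F x"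
  proof -
    have "AE x in lborel. \<forall>n. R n x = V n x"
      using R(3) by (simp add: AE_all_countable)
    then show ?thesis
      using mono_AE_isCont[OF F(1)]
    proof eventually_elim
      case (elim x)
      from lim[OF elim(2)] elim(1) show ?case by simp
    qed
  qed
  ultimately show ?thesis by (intro that[of r F]) (auto simp: profile_def)
qed

text \<open>Fatou's lemma as an eventual strict lower bound: this form stays in the reals and
  matches \<open>order_tendstoI\<close> and \<open>le_Liminf_iff\<close>, where it is used.\<close>

lemma fatou_integral_less:
  fixes f :: "nat \<Rightarrow> 'a \<Rightarrow> real"
  assumes f: "\<And>n. integrable M (f n)" and nn: "\<And>n x. 0 \<le> f n x"
    and lim: "AE x in M. (\<lambda>n. f n x) \<longlonglongrightarrow> F x" and F: "integrable M F" and less: "y < integral\<^sup>L M F"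
  shows "\<forall>\<^sub>F n in sequentially. y < integral\<^sup>L M (f n)"
proof (cases "0 \<le> y")
  \<comment> \<open>Negative bounds are trivial and are split off because \<open>ennreal\<close>
    truncates them to 0.\<close>
  case False
  moreover have "0 \<le> integral\<^sup>L M (f n)" for n using nn by simp
  ultimately show ?thesis by (intro always_eventually allI) (smt (verit))
next
  case True
  have F0: "AE x in M. 0 \<le> F x"
    using lim by eventually_elim (rule LIMSEQ_le_const, use nn in auto)
  have "ennreal y < ennreal (integral\<^sup>L M F)"
    using True less by (simp add: ennreal_less_iff)
  also have "ennreal (integral\<^sup>L M F) = (\<integral>\<^sup>+x. ennreal (F x) \<partial>M)"
    by (rule nn_integral_eq_integral[symmetric, OF F F0])
  also have "\<dots> = (\<integral>\<^sup>+x. liminf (\<lambda>n. ennreal (f n x)) \<partial>M)"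
  proof (rule nn_integral_cong_AE)
    show "AE x in M. ennreal (F x) = liminf (\<lambda>n. ennreal (f n x))"
      using lim by eventually_elim (rule lim_imp_Liminf[symmetric], auto)
  qed
  also have "\<dots> \<le> liminf (\<lambda>n. \<integral>\<^sup>+x. ennreal (f n x) \<partial>M)"
    by (rule nn_integral_liminf) (use f in auto)
  also have "\<dots> = liminf (\<lambda>n. ennreal (integral\<^sup>L M (f n)))"
    using f nn by (simp add: nn_integral_eq_integral)
  finally have "\<forall>\<^sub>F n in sequentially. ennreal y < ennreal (integral\<^sup>L M (f n))"
    by (rule less_LiminfD)
  then show ?thesis
    by eventually_elim (use True in \<open>simp add: ennreal_less_iff\<close>)
qed

text \<open>Here integrability of the limit is a conclusion: nothing is known in advance about the
  energy of a Helly limit.\<close>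

lemma fatou_integrable:
  fixes f :: "nat \<Rightarrow> 'a \<Rightarrow> real"
  assumes f: "\<And>n. integrable M (f n)" and nn: "\<And>n x. 0 \<le> f n x"
    and lim: "AE x in M. (\<lambda>n. f n x) \<longlonglongrightarrow> F x" and F: "F \<in> borel_measurable M"
    and K: "(\<lambda>n. integral\<^sup>L M (f n)) \<longlonglongrightarrow> K"
  shows "integrable M F" "integral\<^sup>L M F \<le> K"
proof -
  have F0: "AE x in M. 0 \<le> F x"
    using lim by eventually_elim (rule LIMSEQ_le_const, use nn in auto)
  have "(\<integral>\<^sup>+x. ennreal (F x) \<partial>M) = (\<integral>\<^sup>+x. liminf (\<lambda>n. ennreal (f n x)) \<partial>M)"
  proof (rule nn_integral_cong_AE)
    show "AE x in M. ennreal (F x) = liminf (\<lambda>n. ennreal (f n x))"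
      using lim by eventually_elim (rule lim_imp_Liminf[symmetric], auto)
  qed
  also have "\<dots> \<le> liminf (\<lambda>n. \<integral>\<^sup>+x. ennreal (f n x) \<partial>M)"
    by (rule nn_integral_liminf) (use f in auto)
  also have "\<dots> = liminf (\<lambda>n. ennreal (integral\<^sup>L M (f n)))"
    using f nn by (simp add: nn_integral_eq_integral)
  also have "\<dots> = ennreal K"
    by (rule lim_imp_Liminf) (use K in auto)
  finally have le: "(\<integral>\<^sup>+x. ennreal (F x) \<partial>M) \<le> ennreal K" .
  then show int: "integrable M F"
    using F F0 by (intro integrableI_nonneg) (auto intro: le_less_trans)
  have "0 \<le> K" by (rule LIMSEQ_le_const[OF K]) (use nn in auto)
  with le show "integral\<^sup>L M F \<le> K"
    by (simp add: nn_integral_eq_integral[OF int F0])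
qed

text \<open>Generalised dominated convergence with varying majorants: Fatou's lemma for
  \<open>G n - f n\<close>, together with convergence of the integrals of \<open>G n\<close>, bounds
  those of \<open>f n\<close> from above.\<close>

lemma integral_tendsto_0_of_dominated:
  fixes f :: "nat \<Rightarrow> 'a \<Rightarrow> real"
  assumes f: "\<And>n. integrable M (f n)" and G: "\<And>n. integrable M (G n)" "integrable M G'"
    and bounds: "\<And>n x. 0 \<le> f n x" "\<And>n x. f n x \<le> G n x"
    and lim: "AE x in M. (\<lambda>n. f n x) \<longlonglongrightarrow> 0" "AE x in M. (\<lambda>n. G n x) \<longlonglongrightarrow> G' x"
    and int: "(\<lambda>n. integral\<^sup>L M (G n)) \<longlonglongrightarrow> integral\<^sup>L M G'"
  shows "(\<lambda>n. integral\<^sup>L M (f n)) \<longlonglongrightarrow> 0"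
proof (rule order_tendstoI)
  fix e :: real assume "e < 0"
  moreover have "0 \<le> integral\<^sup>L M (f n)" for n using bounds(1) by simp
  ultimately show "\<forall>\<^sub>F n in sequentially. e < integral\<^sup>L M (f n)"
    by (intro always_eventually allI) (rule less_le_trans)
next
  fix e :: real assume e: "0 < e"
  have "AE x in M. (\<lambda>n. G n x - f n x) \<longlonglongrightarrow> G' x"
    using lim by eventually_elim (use tendsto_diff in fastforce)
  then have "\<forall>\<^sub>F n in sequentially. integral\<^sup>L M G' - e / 2 < integral\<^sup>L M (\<lambda>x. G n x - f n x)"
    using f G bounds e by (intro fatou_integral_less[where F = G']) auto
  moreover have "\<forall>\<^sub>F n in sequentially. integral\<^sup>L M (G n) < integral\<^sup>L M G' + e / 2"
    using order_tendstoD(2)[OF int] e by simp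
  ultimately show "\<forall>\<^sub>F n in sequentially. integral\<^sup>L M (f n) < e"
  proof eventually_elim
    case (elim n)
    have "integral\<^sup>L M (\<lambda>x. G n x - f n x) = integral\<^sup>L M (G n) - integral\<^sup>L M (f n)"
      using f G by simp
    with elim show ?case by linarith
  qed
qed

section \<open>From convergent integrals over intervals to pointwise limits\<close>

lemma profile_integral_bounds:
  assumes V: "profile V" and "a \<le> b"
  shows "(b - a) * V a \<le> (\<integral>x. indicator {a..b} x * V x \<partial>lborel)"
    and "(\<integral>x. indicator {a..b} x * V x \<partial>lborel) \<le> (b - a) * V b"
proof -
  note meas = profile_measurable[OF V]
  have int: "integrable lborel (\<lambda>x. indicator {a..b} x * V x)"
    by (rule integrable_Icc_bounded[OF meas profile_abs_le[OF V]])
  have cint: "integrable lborel (\<lambda>x. indicator {a..b} x * k)" for k :: real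
    by (rule integrable_Icc_bounded[where B = "\<bar>k\<bar>"]) auto
  have const: "(\<integral>x. indicator {a..b} x * k \<partial>lborel) = (b - a) * k" for k :: real
    using \<open>a \<le> b\<close> by simp
  show "(b - a) * V a \<le> (\<integral>x. indicator {a..b} x * V x \<partial>lborel)"
    unfolding const[symmetric]
    by (rule integral_mono[OF cint int]) (auto simp: indicator_def intro: profile_mono[OF V])
  show "(\<integral>x. indicator {a..b} x * V x \<partial>lborel) \<le> (b - a) * V b"
    unfolding const[symmetric]
    by (rule integral_mono[OF int cint]) (auto simp: indicator_def intro: profile_mono[OF V])
qed

text \<open>Monotonicity squeezes \<open>V n x\<close> between its means over short intervals to the
  left and right of \<open>x\<close>. These means converge, and continuity of \<open>F\<close> at
  \<open>x\<close> keeps their limits close to \<open>F x\<close>.\<close>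

lemma profile_tendsto_of_integrals:
  assumes V: "\<And>n. profile (V n)" and F: "profile F"
    and lim: "\<And>a b. (\<lambda>n. \<integral>x. indicator {a..b} x * V n x \<partial>lborel) \<longlonglongrightarrow> (\<integral>x. indicator {a..b} x * F x \<partial>lborel)"
    and cont: "isCont F x"
  shows "(\<lambda>n. V n x) \<longlonglongrightarrow> F x"
proof (rule order_tendstoI)
  fix y assume "F x < y"
  then have "0 < y - F x" by simp
  then obtain d where d: "0 < d" "\<And>z. dist z x < d \<Longrightarrow> dist (F z) (F x) < y - F x"
    using cont unfolding continuous_at_eps_delta by blast
  define h where "h = d / 2"
  have h: "0 < h" "F (x + h) < y"
    using d(1) d(2)[of "x + h"] by (auto simp: h_def dist_real_def)
  have "(\<integral>z. indicator {x..x + h} z * F z \<partial>lborel) \<le> h * F (x + h)"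
    using profile_integral_bounds(2)[OF F, of x "x + h"] h by simp
  then have "(\<integral>z. indicator {x..x + h} z * F z \<partial>lborel) < h * y"
    using h by (meson le_less_trans mult_strict_left_mono)
  then have "\<forall>\<^sub>F n in sequentially. (\<integral>z. indicator {x..x + h} z * V n z \<partial>lborel) < h * y"
    by (rule order_tendstoD(2)[OF lim])
  then show "\<forall>\<^sub>F n in sequentially. V n x < y"
  proof eventually_elim
    case (elim n)
    have "h * V n x \<le> (\<integral>z. indicator {x..x + h} z * V n z \<partial>lborel)"
      using profile_integral_bounds(1)[OF V[of n], of x "x + h"] h by simp
    from le_less_trans[OF this elim] h show ?case by simp
  qed
next
  fix y assume "y < F x"
  then have "0 < F x - y" by simp
  then obtain d where d: "0 < d" "\<And>z. dist z x < d \<Longrightarrow> dist (F z) (F x) < F x - y"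
    using cont unfolding continuous_at_eps_delta by blast
  define h where "h = d / 2"
  have h: "0 < h" "y < F (x - h)"
    using d(1) d(2)[of "x - h"] by (auto simp: h_def dist_real_def)
  have "h * F (x - h) \<le> (\<integral>z. indicator {x - h..x} z * F z \<partial>lborel)"
    using profile_integral_bounds(1)[OF F, of "x - h" x] h by simp
  then have "h * y < (\<integral>z. indicator {x - h..x} z * F z \<partial>lborel)"
    using h by (meson less_le_trans mult_strict_left_mono)
  then have "\<forall>\<^sub>F n in sequentially. h * y < (\<integral>z. indicator {x - h..x} z * V n z \<partial>lborel)"
    by (rule order_tendstoD(1)[OF lim])
  then show "\<forall>\<^sub>F n in sequentially. y < V n x"
  proof eventually_elim
    case (elim n)
    have "(\<integral>z. indicator {x - h..x} z * V n z \<partial>lborel) \<le> h * V n x"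
      using profile_integral_bounds(2)[OF V[of n], of "x - h" x] h by simp
    from less_le_trans[OF elim this] h show ?case by simp
  qed
qed

text \<open>The limit is known only almost everywhere, so the sign is read off at some good point
  between 0 and \<open>x\<close> and carried to \<open>x\<close> by monotonicity.\<close>

lemma centred_limit:
  assumes F: "profile F" and V: "\<And>n. centred (V n)" and lim: "AE x in lborel. (\<lambda>n. V n x) \<longlonglongrightarrow> F x"
  shows "centred F"
  unfolding centred_def
proof (intro conjI allI impI)
  fix x :: real assume "0 < x"
  then obtain y where y: "0 < y" "y < x" "(\<lambda>n. V n y) \<longlonglongrightarrow> F y"
    using AE_lborel_imp_ex_between[OF lim] by blast
  have "0 \<le> F y" by (rule LIMSEQ_le_const[OF y(3)]) (use V y in \<open>auto simp: centred_def\<close>)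
  also have "\<dots> \<le> F x" using y by (intro profile_mono[OF F]) simp
  finally show "0 \<le> F x" .
next
  fix x :: real assume "x < 0"
  then obtain y where y: "x < y" "y < 0" "(\<lambda>n. V n y) \<longlonglongrightarrow> F y"
    using AE_lborel_imp_ex_between[OF lim] by blast
  have "F x \<le> F y" using y by (intro profile_mono[OF F]) simp
  also have "\<dots> \<le> 0" by (rule LIMSEQ_le_const2[OF y(3)]) (use V y in \<open>auto simp: centred_def\<close>)
  finally show "F x \<le> 0" .
qed

section \<open>Representatives of the elements of the cone\<close>

lemma Wsh_measurable [measurable]: "Wsh \<in> borel_measurable borel"
  by (rule profile_measurable[OF front_imp_profile[OF front_Wsh]])

lemma integral_ge_on_Icc:
  fixes f :: "real \<Rightarrow> real"
  assumes f: "integrable lborel f" and "\<And>x. 0 \<le> f x" and "a \<le> b" and "\<And>x. x \<in> {a..b} \<Longrightarrow> k \<le> f x"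
  shows "(b - a) * k \<le> integral\<^sup>L lborel f"
proof -
  have "(\<integral>x. indicator {a..b} x * k \<partial>lborel) \<le> integral\<^sup>L lborel f"
  proof (rule integral_mono[OF _ f])
    show "integrable lborel (\<lambda>x. indicator {a..b} x * k)"
      by (rule integrable_Icc_bounded[where B = "\<bar>k\<bar>"]) auto
    show "indicator {a..b} x * k \<le> f x" for x
      using assms(2,4) by (auto simp: indicator_def)
  qed
  with \<open>a \<le> b\<close> show ?thesis by simp
qed

text \<open>If a profile stayed below some \<open>y < 1\<close>, it would keep distance at least
  \<open>1 - y\<close> from \<open>Wsh\<close> on a whole half-line, contradicting finite
  \<open>L2\<close> distance; similarly at -1.\<close>

lemma front_of_profile:
  assumes V: "profile V" and L2: "integrable lborel (\<lambda>x. (Wsh x - V x)\<^sup>2)"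
  shows "front V"
proof -
  have no: False if k: "0 < k" "\<And>n. real n * k \<le> (\<integral>x. (Wsh x - V x)\<^sup>2 \<partial>lborel)" for k
  proof -
    obtain n :: nat where "(\<integral>x. (Wsh x - V x)\<^sup>2 \<partial>lborel) < real n * k"
      using reals_Archimedean3[OF k(1)] by blast
    with k(2)[of n] show False by simp
  qed
  have "(V \<longlongrightarrow> 1) at_top"
  proof (rule order_tendstoI)
    fix y :: real assume y: "y < 1"
    have "\<exists>x0. y < V x0"
    proof (rule ccontr)
      assume "\<not> (\<exists>x0. y < V x0)"
      then have le: "V x \<le> y" for x by (simp add: not_less)
      have "real n * (1 - y)\<^sup>2 \<le> (\<integral>x. (Wsh x - V x)\<^sup>2 \<partial>lborel)" for n
      proof -
        have ge: "(1 - y)\<^sup>2 \<le> (Wsh x - V x)\<^sup>2" if "x \<in> {1..1 + real n}" for x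
          using that y le[of x] by (intro power_mono) auto
        have "(1 + real n - 1) * (1 - y)\<^sup>2 \<le> (\<integral>x. (Wsh x - V x)\<^sup>2 \<partial>lborel)"
          by (rule integral_ge_on_Icc[OF L2 _ _ ge]) simp_all
        then show ?thesis by simp
      qed
      then show False using no[of "(1 - y)\<^sup>2"] y by simp
    qed
    then obtain x0 where "y < V x0" ..
    then have "y < V x" if "x0 \<le> x" for x using profile_mono[OF V that] by simp
    then show "\<forall>\<^sub>F x in at_top. y < V x" by (auto simp: eventually_at_top_linorder)
  next
    fix y :: real assume "1 < y"
    moreover have "V x \<le> 1" for x using profile_abs_le[OF V, of x] by simp
    ultimately show "\<forall>\<^sub>F x in at_top. V x < y" by (intro always_eventually allI) (rule le_less_trans)
  qed
  moreover have "(V \<longlongrightarrow> -1) at_bot"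
  proof (rule order_tendstoI)
    fix y :: real assume y: "-1 < y"
    have "\<exists>x0. V x0 < y"
    proof (rule ccontr)
      assume "\<not> (\<exists>x0. V x0 < y)"
      then have le: "y \<le> V x" for x by (simp add: not_less)
      have "real n * (1 + y)\<^sup>2 \<le> (\<integral>x. (Wsh x - V x)\<^sup>2 \<partial>lborel)" for n
      proof -
        have ge: "(1 + y)\<^sup>2 \<le> (Wsh x - V x)\<^sup>2" if "x \<in> {- 1 - real n..- 1}" for x
          unfolding power2_commute[of "Wsh x"]
          using that y le[of x] by (intro power_mono) auto
        have "(- 1 - (- 1 - real n)) * (1 + y)\<^sup>2 \<le> (\<integral>x. (Wsh x - V x)\<^sup>2 \<partial>lborel)"
          by (rule integral_ge_on_Icc[OF L2 _ _ ge]) simp_all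
        then show ?thesis by simp
      qed
      then show False using no[of "(1 + y)\<^sup>2"] y by simp
    qed
    then obtain x0 where "V x0 < y" ..
    then have "V x < y" if "x \<le> x0" for x using profile_mono[OF V that] by simp
    then show "\<forall>\<^sub>F x in at_bot. V x < y" by (auto simp: eventually_at_bot_linorder)
  next
    fix y :: real assume "y < -1"
    moreover have "-1 \<le> V x" for x using profile_abs_le[OF V, of x] by simp
    ultimately show "\<forall>\<^sub>F x in at_bot. y < V x" by (intro always_eventually allI) (rule less_le_trans)
  qed
  ultimately show ?thesis using V by (simp add: front_def profile_def)
qed

text \<open>Passes from a class in the completed measure to a monotone, hence Borel, representative,
  so that the analysis can take place over \<open>lborel\<close>.\<close>

lemma Cset_representative:
  assumes "W \<in> Cset"
  obtains V where "front V" "AE x in lebesgue. W x = V x" "integrable lborel (\<lambda>x. (Wsh x - V x)\<^sup>2)"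
    "W \<in> borel_measurable lebesgue"
proof -
  obtain V where V: "front V" "AE x in lebesgue. W x = V x"
    using assms unfolding Cset_def front_def by blast
  have W: "W \<in> borel_measurable lebesgue" "integrable lebesgue (\<lambda>x. (Wsh x - W x)\<^sup>2)"
    using assms by (auto simp: Cset_def Hsp_def L2_def)
  have VB: "V \<in> borel_measurable borel"
    by (rule profile_measurable[OF front_imp_profile[OF V(1)]])
  then have m: "(\<lambda>x. (Wsh x - V x)\<^sup>2) \<in> borel_measurable lborel" by measurable
  have "integrable lebesgue (\<lambda>x. (Wsh x - V x)\<^sup>2)"
  proof (rule integrable_cong_AE_imp[OF W(2) measurable_completion[OF m]])
    show "AE x in lebesgue. (Wsh x - W x)\<^sup>2 = (Wsh x - V x)\<^sup>2"
      using V(2) by eventually_elim simp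
  qed
  then have "integrable lborel (\<lambda>x. (Wsh x - V x)\<^sup>2)"
    by (simp only: integrable_completion[OF m])
  with V W(1) show ?thesis by (intro that)
qed

lemma front_L2:
  assumes "front V" "integrable lborel (\<lambda>x. (Wsh x - V x)\<^sup>2)"
  shows "(\<lambda>x. Wsh x - V x) \<in> L2"
proof -
  have VB: "V \<in> borel_measurable borel"
    by (rule profile_measurable[OF front_imp_profile[OF assms(1)]])
  have "(\<lambda>x. Wsh x - V x) \<in> borel_measurable lborel" using VB by measurable
  moreover have "(\<lambda>x. (Wsh x - V x)\<^sup>2) \<in> borel_measurable lborel" using VB by measurable
  ultimately show ?thesis
    using assms(2) by (simp only: L2_def mem_Collect_eq integrable_completion measurable_completion simp_thms)
qed

lemma front_in_Cset:
  assumes "front V" "integrable lborel (\<lambda>x. (Wsh x - V x)\<^sup>2)"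
  shows "V \<in> Cset"
proof -
  have VB: "V \<in> borel_measurable lborel"
    using profile_measurable[OF front_imp_profile[OF assms(1)]] by simp
  with front_L2[OF assms] have "V \<in> Hsp"
    by (simp only: Hsp_def mem_Collect_eq measurable_completion simp_thms)
  with assms(1) show ?thesis unfolding Cset_def front_def by auto
qed

lemma C0set_representative:
  assumes "W \<in> C0set"
  obtains V where "front V" "centred V" "AE x in lebesgue. W x = V x"
    "integrable lborel (\<lambda>x. (Wsh x - V x)\<^sup>2)" "W \<in> borel_measurable lebesgue"
proof -
  have W: "W \<in> Cset" "AE x in lebesgue. 0 \<le> x \<longrightarrow> 0 \<le> W x \<and> W x \<le> 1"
    "AE x in lebesgue. x \<le> 0 \<longrightarrow> -1 \<le> W x \<and> W x \<le> 0"
    using assms by (auto simp: C0set_def)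
  obtain V where V: "front V" "AE x in lebesgue. W x = V x" "integrable lborel (\<lambda>x. (Wsh x - V x)\<^sup>2)"
    "W \<in> borel_measurable lebesgue"
    by (rule Cset_representative[OF W(1)])
  note P = front_imp_profile[OF V(1)]
  have "AE x in lebesgue. (0 \<le> x \<longrightarrow> 0 \<le> V x) \<and> (x \<le> 0 \<longrightarrow> V x \<le> 0)"
    using V(2) W(2,3) by eventually_elim auto
  then have sign: "AE x in lborel. (0 \<le> x \<longrightarrow> 0 \<le> V x) \<and> (x \<le> 0 \<longrightarrow> V x \<le> 0)"
    by (simp only: AE_completion_iff)
  have "centred V"
    unfolding centred_def
  proof (intro conjI allI impI)
    fix x :: real assume "0 < x"
    then obtain y where y: "0 < y" "y < x" "0 \<le> V y"
      using AE_lborel_imp_ex_between[OF sign, of 0 x] by auto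
    then show "0 \<le> V x" using profile_mono[OF P, of y x] by simp
  next
    fix x :: real assume "x < 0"
    then obtain y where y: "x < y" "y < 0" "V y \<le> 0"
      using AE_lborel_imp_ex_between[OF sign, of x 0] by auto
    then show "V x \<le> 0" using profile_mono[OF P, of x y] by simp
  qed
  with V show ?thesis by (intro that)
qed

text \<open>A front is negative far to the left and positive far to the right, so the supremum
  \<open>a\<close> of the points with \<open>V x \<le> 0\<close> exists; it is a point of sign
  change and is moved to 0.\<close>

lemma front_centred_shift:
  assumes "front V"
  obtains a where "front (\<lambda>x. V (x + a))" "centred (\<lambda>x. V (x + a))"
proof -
  note P = front_imp_profile[OF assms]
  define S where "S = {x. V x \<le> 0}"
  define a where "a = Sup S"
  have "\<forall>\<^sub>F x in at_top. 0 < V x"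
    using assms by (intro order_tendstoD(1)[of V 1]) (auto simp: front_def)
  then obtain N where N: "\<And>x. N \<le> x \<Longrightarrow> 0 < V x" by (auto simp: eventually_at_top_linorder)
  have "x \<le> N" if "x \<in> S" for x
    using N[of x] that by (cases "N \<le> x") (auto simp: S_def)
  then have bdd: "bdd_above S" by (rule bdd_aboveI)
  have "\<forall>\<^sub>F x in at_bot. V x < 0"
    using assms by (intro order_tendstoD(2)[of V "-1"]) (auto simp: front_def)
  then obtain N' where "\<And>x. x \<le> N' \<Longrightarrow> V x < 0" by (auto simp: eventually_at_bot_linorder)
  then have "N' \<in> S" by (simp add: S_def less_imp_le)
  then have ne: "S \<noteq> {}" by blast
  have "0 \<le> V (x + a)" if "0 < x" for x
  proof (rule ccontr)
    assume "\<not> 0 \<le> V (x + a)"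
    then have "x + a \<in> S" by (simp add: S_def)
    then have "x + a \<le> a" unfolding a_def using bdd by (rule cSup_upper)
    with that show False by simp
  qed
  moreover have "V (x + a) \<le> 0" if "x < 0" for x
  proof -
    have "x + a < Sup S" using that by (simp add: a_def)
    then obtain y where "y \<in> S" "x + a < y" using less_cSupD[OF ne] by blast
    then show ?thesis using profile_mono[OF P, of "x + a" y] by (simp add: S_def)
  qed
  ultimately have "centred (\<lambda>x. V (x + a))" by (simp add: centred_def)
  moreover have "front (\<lambda>x. V (x + a))"
  proof -
    have "mono (\<lambda>x. V (x + a))" using P by (auto simp: profile_def mono_def)
    moreover have "((\<lambda>x. V (x + a)) \<longlongrightarrow> 1) at_top"
    proof (rule filterlim_compose[of V])
      show "filterlim (\<lambda>x. x + a) at_top at_top"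
        by (rule filterlim_tendsto_add_at_top[OF tendsto_const filterlim_ident, of a, unfolded add.commute[of a]])
    qed (use assms in \<open>simp add: front_def\<close>)
    moreover have "((\<lambda>x. V (x + a)) \<longlongrightarrow> -1) at_bot"
    proof (rule filterlim_compose[of V])
      show "filterlim (\<lambda>x. x + a) at_bot at_bot"
        unfolding filterlim_at_bot eventually_at_bot_linorder by (metis le_diff_eq)
    qed (use assms in \<open>simp add: front_def\<close>)
    ultimately show ?thesis by (simp add: front_def)
  qed
  ultimately show ?thesis by (intro that)
qed

text \<open>Indicators of bounded intervals are admissible test functions, so weak convergence
  yields convergence of integrals over intervals once the common \<open>Wsh\<close> part is
  cancelled. Monotonicity does the rest.\<close>

lemma weak_L2_conv_profiles_AE:
  assumes V: "\<And>n. profile (V n)" and F: "profile F"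
    and WV: "\<And>n. AE x in lebesgue. W n x = V n x" "\<And>n. W n \<in> borel_measurable lebesgue"
    and WF: "AE x in lebesgue. Winf x = F x" "Winf \<in> borel_measurable lebesgue"
    and weak: "weak_L2_conv (\<lambda>n x. Wsh x - W n x) (\<lambda>x. Wsh x - Winf x)"
  shows "AE x in lborel. (\<lambda>n. V n x) \<longlonglongrightarrow> F x"
proof -
  have "(\<lambda>n. \<integral>x. indicator {a..b} x * V n x \<partial>lborel) \<longlonglongrightarrow> (\<integral>x. indicator {a..b} x * F x \<partial>lborel)" for a b
  proof -
    have test: "(indicator {a..b} :: real \<Rightarrow> real) \<in> L2"
    proof -
      have "(\<lambda>x. (indicator {a..b} x :: real)\<^sup>2) = indicator {a..b}" by (auto simp: indicator_def)
      moreover have "integrable lebesgue (indicator {a..b} :: real \<Rightarrow> real)"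
        by (simp add: integrable_completion integrable_indicator_iff emeasure_lborel_Icc_eq)
      ultimately show ?thesis by (simp add: L2_def)
    qed
    have eq: "(\<integral>x. (Wsh x - U x) * indicator {a..b} x \<partial>lebesgue)
        = (\<integral>x. indicator {a..b} x * Wsh x \<partial>lborel) - (\<integral>x. indicator {a..b} x * Y x \<partial>lborel)"
      if Y: "profile Y" and U: "AE x in lebesgue. U x = Y x" "U \<in> borel_measurable lebesgue" for U Y
    proof -
      note meas = profile_measurable[OF Y]
      have m: "(\<lambda>x. indicator {a..b} x * Wsh x - indicator {a..b} x * Y x) \<in> borel_measurable lborel"
        using meas by measurable
      have Wl: "Wsh \<in> borel_measurable lebesgue" by (rule measurable_completion) simp
      have "(\<integral>x. (Wsh x - U x) * indicator {a..b} x \<partial>lebesgue)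
        = (\<integral>x. indicator {a..b} x * Wsh x - indicator {a..b} x * Y x \<partial>lebesgue)"
      proof (rule integral_cong_AE)
        show "AE x in lebesgue. (Wsh x - U x) * indicator {a..b} x = indicator {a..b} x * Wsh x - indicator {a..b} x * Y x"
          using U(1) by eventually_elim (simp add: algebra_simps)
        show "(\<lambda>x. (Wsh x - U x) * indicator {a..b} x) \<in> borel_measurable lebesgue"
          by (intro borel_measurable_times borel_measurable_diff Wl U(2) measurable_completion) simp
      qed (rule measurable_completion[OF m])
      also have "\<dots> = (\<integral>x. indicator {a..b} x * Wsh x - indicator {a..b} x * Y x \<partial>lborel)"
        by (rule integral_completion[OF m])
      also have "\<dots> = (\<integral>x. indicator {a..b} x * Wsh x \<partial>lborel) - (\<integral>x. indicator {a..b} x * Y x \<partial>lborel)"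
        by (rule Bochner_Integration.integral_diff; rule integrable_Icc_bounded[where B = 1])
           (use meas profile_abs_le[OF Y] profile_abs_le[OF front_imp_profile[OF front_Wsh]] in auto)
      finally show ?thesis .
    qed
    let ?w = "\<integral>x. indicator {a..b} x * Wsh x \<partial>lborel"
    have "(\<lambda>n. ?w - (\<integral>x. indicator {a..b} x * V n x \<partial>lborel)) \<longlonglongrightarrow> ?w - (\<integral>x. indicator {a..b} x * F x \<partial>lborel)"
      using weak[unfolded weak_L2_conv_def, rule_format, OF test]
      by (simp only: eq[OF V WV(1) WV(2)] eq[OF F WF])
    from tendsto_diff[OF tendsto_const[of ?w] this] show ?thesis by simp
  qed
  note * = profile_tendsto_of_integrals[OF V F this]
  have "mono F" using F by (simp add: profile_def)
  from mono_AE_isCont[OF this] show ?thesis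
    by eventually_elim (rule *)
qed

section \<open>The variational problem for a double well\<close>

context double_well
begin

text \<open>\<open>\<Phi>\<close> is evaluated only at averages, which lie in \<open>[-1,1]\<close>,
  so it may be replaced by \<open>g\<close>; the constant \<open>k\<close> cancels against the
  \<open>Wsh\<close> term.\<close>

lemma Lag_eq_dens:
  assumes \<Phi>: "\<And>w. \<bar>w\<bar> \<le> 1 \<Longrightarrow> g w = w\<^sup>2 / 2 - \<Phi> w - k"
    and V: "front V" "integrable lborel (\<lambda>x. (Wsh x - V x)\<^sup>2)"
    and W: "AE x in lebesgue. W x = V x" "W \<in> borel_measurable lebesgue"
  shows "Lag \<Phi> W = integral\<^sup>L lborel (dens V) - integral\<^sup>L lborel (dens Wsh)"
proof -
  note P = front_imp_profile[OF V(1)] and P0 = front_imp_profile[OF front_Wsh]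
  note meas = profile_measurable[OF P]
  have opW: "opA W = opA V"
    by (rule opA_cong_AE[OF W(1,2)]) (rule measurable_completion, use meas in simp)
  let ?l = "\<lambda>V x. (V x)\<^sup>2 / 2 - (opA V x)\<^sup>2 / 2 + g (opA V x)"
  have int: "integrable lborel (?l V)" "integrable lborel (?l Wsh)"
    by (rule integrable_lagrangian[OF V], rule integrable_lagrangian[OF front_Wsh]) simp
  then have m: "(\<lambda>x. ?l V x - ?l Wsh x) \<in> borel_measurable lborel" by measurable
  \<comment> \<open>Everything except \<open>(W x)\<^sup>2 / 2\<close> is Borel; that term is kept
    apart because \<open>W\<close> is only Lebesgue measurable.\<close>
  have op: "(\<lambda>x. - (opA V x)\<^sup>2 / 2 + g (opA V x) - ?l Wsh x) \<in> borel_measurable lebesgue"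
    by (rule measurable_completion) (use meas in measurable)
  have eq: "((1/2) * (W x)\<^sup>2 - \<Phi> (opA W x)) - ((1/2) * (Wsh x)\<^sup>2 - \<Phi> (opA Wsh x))
      = (W x)\<^sup>2 / 2 + (- (opA V x)\<^sup>2 / 2 + g (opA V x) - ?l Wsh x)" for x
    unfolding opW \<Phi>[OF profile_opA_bounds(3)[OF P]] \<Phi>[OF profile_opA_bounds(3)[OF P0]] by simp
  have "Lag \<Phi> W = (\<integral>x. (W x)\<^sup>2 / 2 + (- (opA V x)\<^sup>2 / 2 + g (opA V x) - ?l Wsh x) \<partial>lebesgue)"
    unfolding Lag_def eq ..
  also have "\<dots> = (\<integral>x. ?l V x - ?l Wsh x \<partial>lebesgue)"
  proof (rule integral_cong_AE)
    show "AE x in lebesgue. (W x)\<^sup>2 / 2 + (- (opA V x)\<^sup>2 / 2 + g (opA V x) - ?l Wsh x) = ?l V x - ?l Wsh x"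
      using W(1) by eventually_elim simp
    have "(\<lambda>x. (W x)\<^sup>2 / 2) \<in> borel_measurable lebesgue" using W(2) by measurable
    then show "(\<lambda>x. (W x)\<^sup>2 / 2 + (- (opA V x)\<^sup>2 / 2 + g (opA V x) - ?l Wsh x)) \<in> borel_measurable lebesgue"
      by (rule borel_measurable_add[OF _ op])
  qed (rule measurable_completion[OF m])
  also have "\<dots> = (\<integral>x. ?l V x - ?l Wsh x \<partial>lborel)"
    by (rule integral_completion[OF m])
  also have "\<dots> = integral\<^sup>L lborel (?l V) - integral\<^sup>L lborel (?l Wsh)"
    by (rule Bochner_Integration.integral_diff[OF int])
  also have "integral\<^sup>L lborel (?l V) = integral\<^sup>L lborel (dens V)"
    by (rule integral_lagrangian[OF V])
  also have "integral\<^sup>L lborel (?l Wsh) = integral\<^sup>L lborel (dens Wsh)"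
    by (rule integral_lagrangian[OF front_Wsh]) simp
  finally show ?thesis .
qed

lemma integral_dens_shift:
  assumes V: "front V" "integrable lborel (dens V)"
  shows "integrable lborel (dens (\<lambda>x. V (x + a)))"
    and "integral\<^sup>L lborel (dens (\<lambda>x. V (x + a))) = integral\<^sup>L lborel (dens V)"
proof -
  have "dens (\<lambda>x. V (x + a)) = (\<lambda>x. dens V (x + a))"
    by (rule ext) (rule dens_shift[OF profile_measurable[OF front_imp_profile[OF V(1)]]])
  then show "integrable lborel (dens (\<lambda>x. V (x + a)))"
    "integral\<^sup>L lborel (dens (\<lambda>x. V (x + a))) = integral\<^sup>L lborel (dens V)"
    using integrable_shift[OF V(2), of a] integral_shift[of "dens V" a] by simp_all
qed

text \<open>Helly's theorem alone allows degenerate limits such as the constant 0. The energy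
  excludes them: Fatou's lemma makes \<open>dens F\<close> integrable, centring converts this into
  finite \<open>L2\<close> distance from \<open>Wsh\<close>, and that forces the limits at
  infinity.\<close>

lemma bounded_energy_compactness:
  assumes V: "\<And>n. profile (V n)" "\<And>n. centred (V n)" "\<And>n. integrable lborel (dens (V n))"
    and K: "(\<lambda>n. integral\<^sup>L lborel (dens (V n))) \<longlonglongrightarrow> K"
  obtains r F where "strict_mono (r :: nat \<Rightarrow> nat)" "front F" "centred F"
    "integrable lborel (\<lambda>x. (Wsh x - F x)\<^sup>2)" "integral\<^sup>L lborel (dens F) \<le> K"
    "AE x in lborel. (\<lambda>n. V (r n) x) \<longlonglongrightarrow> F x"
proof -
  obtain r F where r: "strict_mono (r :: nat \<Rightarrow> nat)" and F: "profile F"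
    and lim: "AE x in lborel. (\<lambda>n. V (r n) x) \<longlonglongrightarrow> F x"
    by (rule profile_selection[of V, OF V(1)])
  have cF: "centred F" by (rule centred_limit[OF F V(2) lim])
  have dlim: "AE x in lborel. (\<lambda>n. dens (V (r n)) x) \<longlonglongrightarrow> dens F x"
    by (intro AE_I2 dens_tendsto V(1) F lim)
  have Kr: "(\<lambda>n. integral\<^sup>L lborel (dens (V (r n)))) \<longlonglongrightarrow> K"
    using LIMSEQ_subseq_LIMSEQ[OF K r] by (simp add: o_def)
  have m: "dens F \<in> borel_measurable lborel"
    using profile_measurable[OF F] by measurable
  note fatou = fatou_integrable[OF V(3) dens_nonneg[OF V(1)] dlim m Kr]
  have L2: "integrable lborel (\<lambda>x. (Wsh x - F x)\<^sup>2)"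
    by (rule integrable_distance[OF F cF fatou(1)])
  show ?thesis
    by (rule that[OF r front_of_profile[OF F L2] cF L2 fatou(2) lim])
qed

lemma L2_convergence_of_energy_convergence:
  assumes V: "\<And>n. profile (V n)" "\<And>n. centred (V n)" "\<And>n. integrable lborel (dens (V n))"
    and F: "profile F" "centred F" "integrable lborel (dens F)"
    and lim: "AE x in lborel. (\<lambda>n. V n x) \<longlonglongrightarrow> F x"
    and int: "(\<lambda>n. integral\<^sup>L lborel (dens (V n))) \<longlonglongrightarrow> integral\<^sup>L lborel (dens F)"
  shows "(\<lambda>n. \<integral>x. (V n x - F x)\<^sup>2 \<partial>lborel) \<longlonglongrightarrow> 0"
proof -
  \<comment> \<open>The majorant from \<open>distance_le_dens\<close>. It depends on
    \<open>n\<close>, but converges pointwise and in integral, as the generalised dominated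
    convergence requires.\<close>
  define H where "H U x = (dens U (x - 1/2) + dens U (x + 1/2)) / c + indicator {-1..1} x" for U and x :: real
  have H: "integrable lborel (H U)" "integral\<^sup>L lborel (H U) = 2 * integral\<^sup>L lborel (dens U) / c + 2"
    if "integrable lborel (dens U)" for U
    unfolding H_def using integrable_distance_bound[OF that] by simp_all
  have bound: "(V n x - F x)\<^sup>2 \<le> 2 * H (V n) x + 2 * H F x" for n x
  proof -
    have "(V n x - F x)\<^sup>2 \<le> 2 * (Wsh x - V n x)\<^sup>2 + 2 * (Wsh x - F x)\<^sup>2"
    proof -
      \<comment> \<open>With \<open>a\<close> and \<open>b\<close> the two distances to
        \<open>Wsh\<close>, the gap between \<open>2 * a\<^sup>2 + 2 * b\<^sup>2\<close> and
        \<open>(a - b)\<^sup>2\<close> is \<open>(a + b)\<^sup>2\<close>.\<close>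
      have "0 \<le> ((Wsh x - V n x) + (Wsh x - F x))\<^sup>2" by simp
      then show ?thesis by (simp add: power2_eq_square algebra_simps)
    qed
    also have "\<dots> \<le> 2 * H (V n) x + 2 * H F x"
    proof -
      have "(Wsh x - V n x)\<^sup>2 \<le> H (V n) x" "(Wsh x - F x)\<^sup>2 \<le> H F x"
        unfolding H_def by (rule distance_le_dens[OF V(1,2)], rule distance_le_dens[OF F(1,2)])
      then show ?thesis by linarith
    qed
    finally show ?thesis .
  qed
  have Gint: "integrable lborel (\<lambda>x. 2 * H (V n) x + 2 * H F x)" for n
    by (intro Bochner_Integration.integrable_add integrable_mult_right H V F)
  show ?thesis
  proof (rule integral_tendsto_0_of_dominated[OF _ Gint])
    show "integrable lborel (\<lambda>x. (V n x - F x)\<^sup>2)" for n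
    proof (rule integrable_abs_le[OF Gint])
      show "(\<lambda>x. (V n x - F x)\<^sup>2) \<in> borel_measurable lborel"
        using profile_measurable[OF V(1), of n] profile_measurable[OF F(1)] by measurable
    qed (use bound in simp)
    show "integrable lborel (\<lambda>x. 2 * H F x + 2 * H F x)"
      by (intro Bochner_Integration.integrable_add integrable_mult_right H F)
    show "AE x in lborel. (\<lambda>n. (V n x - F x)\<^sup>2) \<longlonglongrightarrow> 0"
      using lim
    proof eventually_elim
      case (elim x)
      from tendsto_power[OF tendsto_diff[OF elim tendsto_const[of "F x"]], of 2] show ?case by simp
    qed
    have "(\<lambda>n. H (V n) x) \<longlonglongrightarrow> H F x" for x
      unfolding H_def by (intro tendsto_intros dens_tendsto V F lim) (use c_pos in simp)
    then show "AE x in lborel. (\<lambda>n. 2 * H (V n) x + 2 * H F x) \<longlonglongrightarrow> 2 * H F x + 2 * H F x"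
      by (intro AE_I2 tendsto_intros)
    have eq: "(\<integral>x. 2 * H U x + 2 * H F x \<partial>lborel)
        = 2 * (2 * integral\<^sup>L lborel (dens U) / c + 2) + 2 * (2 * integral\<^sup>L lborel (dens F) / c + 2)"
      if "integrable lborel (dens U)" for U
      using H[OF that] H[OF F(3)] by simp
    show "(\<lambda>n. \<integral>x. 2 * H (V n) x + 2 * H F x \<partial>lborel) \<longlonglongrightarrow> (\<integral>x. 2 * H F x + 2 * H F x \<partial>lborel)"
      unfolding eq[OF V(3)] eq[OF F(3)] by (intro tendsto_intros int) (use c_pos in simp)
  qed (use bound in auto)
qed

end

text \<open>The link between \<open>g\<close> and \<open>\<Phi>\<close> is confined to
  \<open>[-1,1]\<close>, so \<open>g\<close> may be any continuous extension beyond it.\<close>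

locale front_lagrangian = double_well +
  fixes \<Phi> :: "real \<Rightarrow> real" and k :: real
  assumes g_eq: "\<bar>w\<bar> \<le> 1 \<Longrightarrow> g w = w\<^sup>2 / 2 - \<Phi> w - k"
begin

section \<open>Lower semicontinuity, existence of a minimiser, strong compactness\<close>

lemmas Lag_eq = Lag_eq_dens[OF g_eq]

lemma Lag_front:
  assumes V: "front V" "integrable lborel (\<lambda>x. (Wsh x - V x)\<^sup>2)"
  shows "Lag \<Phi> V = integral\<^sup>L lborel (dens V) - integral\<^sup>L lborel (dens Wsh)"
proof (rule Lag_eq[OF _ V])
  show "V \<in> borel_measurable lebesgue"
    by (rule measurable_completion) (use profile_measurable[OF front_imp_profile[OF V(1)]] in simp)
qed auto

text \<open>Nonnegativity of \<open>dens\<close> gives the bound, and a real-valued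
  \<open>INF\<close> is a genuine infimum only for nonempty sets that are bounded below.\<close>

lemma Lag_bdd_below: "bdd_below (Lag \<Phi> ` Cset)"
proof (rule bdd_belowI2)
  fix W assume "W \<in> Cset"
  then obtain V where V: "front V" "AE x in lebesgue. W x = V x" "integrable lborel (\<lambda>x. (Wsh x - V x)\<^sup>2)"
    "W \<in> borel_measurable lebesgue"
    by (rule Cset_representative)
  have "Lag \<Phi> W = integral\<^sup>L lborel (dens V) - integral\<^sup>L lborel (dens Wsh)"
    by (rule Lag_eq[OF _ V(1,3,2,4)])
  moreover have "0 \<le> integral\<^sup>L lborel (dens V)"
    using dens_nonneg[OF front_imp_profile[OF V(1)]] by simp
  ultimately show "- integral\<^sup>L lborel (dens Wsh) \<le> Lag \<Phi> W" by simp
qed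

lemma Lag_weakly_lower_semicontinuous:
  assumes Wt: "\<And>n. Wt n \<in> C0tilde" and Wtinf: "Wtinf \<in> C0tilde" and weak: "weak_L2_conv Wt Wtinf"
  shows "ereal (Lag \<Phi> (\<lambda>x. Wsh x - Wtinf x)) \<le> liminf (\<lambda>n. ereal (Lag \<Phi> (\<lambda>x. Wsh x - Wt n x)))"
proof -
  have rep: "\<exists>V. front V \<and> integrable lborel (\<lambda>x. (Wsh x - V x)\<^sup>2) \<and> (AE x in lebesgue. Wsh x - U x = V x)
      \<and> (\<lambda>x. Wsh x - U x) \<in> borel_measurable lebesgue" if U: "U \<in> C0tilde" for U
  proof -
    obtain W where W: "U = (\<lambda>x. Wsh x - W x)" "W \<in> C0set"
      using U by (auto simp: C0tilde_def)
    obtain V where "front V" "centred V" "AE x in lebesgue. W x = V x"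
      "integrable lborel (\<lambda>x. (Wsh x - V x)\<^sup>2)" "W \<in> borel_measurable lebesgue"
      by (rule C0set_representative[OF W(2)])
    then show ?thesis unfolding W(1) by auto
  qed
  obtain V where V: "\<And>n. front (V n)" "\<And>n. integrable lborel (\<lambda>x. (Wsh x - V n x)\<^sup>2)"
    "\<And>n. AE x in lebesgue. Wsh x - Wt n x = V n x" "\<And>n. (\<lambda>x. Wsh x - Wt n x) \<in> borel_measurable lebesgue"
    using rep[OF Wt] by metis
  obtain F where F: "front F" "integrable lborel (\<lambda>x. (Wsh x - F x)\<^sup>2)"
    "AE x in lebesgue. Wsh x - Wtinf x = F x" "(\<lambda>x. Wsh x - Wtinf x) \<in> borel_measurable lebesgue"
    using rep[OF Wtinf] by metis
  note P = front_imp_profile[OF V(1)] and PF = front_imp_profile[OF F(1)]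
  have lim: "AE x in lborel. (\<lambda>n. V n x) \<longlonglongrightarrow> F x"
    by (rule weak_L2_conv_profiles_AE[OF P PF V(3,4) F(3,4)]) (use weak in simp)
  have dlim: "AE x in lborel. (\<lambda>n. dens (V n) x) \<longlonglongrightarrow> dens F x"
    by (intro AE_I2 dens_tendsto P PF lim)
  have Lag_V: "Lag \<Phi> (\<lambda>x. Wsh x - Wt n x) = integral\<^sup>L lborel (dens (V n)) - integral\<^sup>L lborel (dens Wsh)" for n
    by (rule Lag_eq[OF _ V])
  have Lag_F: "Lag \<Phi> (\<lambda>x. Wsh x - Wtinf x) = integral\<^sup>L lborel (dens F) - integral\<^sup>L lborel (dens Wsh)"
    by (rule Lag_eq[OF _ F])
  have real: "\<forall>\<^sub>F n in sequentially. y < Lag \<Phi> (\<lambda>x. Wsh x - Wt n x)" if "y < Lag \<Phi> (\<lambda>x. Wsh x - Wtinf x)" for y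
  proof -
    have "y + integral\<^sup>L lborel (dens Wsh) < integral\<^sup>L lborel (dens F)" using that Lag_F by simp
    from fatou_integral_less[OF integrable_dens[OF V(1,2)] dens_nonneg[OF P] dlim integrable_dens[OF F(1,2)] this]
    show ?thesis by eventually_elim (simp add: Lag_V)
  qed
  show ?thesis
    unfolding le_Liminf_iff
  proof (intro allI impI)
    fix y assume "y < ereal (Lag \<Phi> (\<lambda>x. Wsh x - Wtinf x))"
    then show "\<forall>\<^sub>F n in sequentially. y < ereal (Lag \<Phi> (\<lambda>x. Wsh x - Wt n x))"
      \<comment> \<open>Real \<open>y\<close> is the Fatou bound; minus infinity is trivial and plus
        infinity contradicts the assumption.\<close>
      using real by (cases y) auto
  qed
qed

lemma front_attains_infimum:
  assumes F: "front F" "integrable lborel (\<lambda>x. (Wsh x - F x)\<^sup>2)"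
    and le: "integral\<^sup>L lborel (dens F) \<le> (INF V\<in>Cset. Lag \<Phi> V) + integral\<^sup>L lborel (dens Wsh)"
  shows "F \<in> Cset" "Lag \<Phi> F = (INF V\<in>Cset. Lag \<Phi> V)"
proof -
  show "F \<in> Cset" by (rule front_in_Cset[OF F])
  then have "(INF V\<in>Cset. Lag \<Phi> V) \<le> Lag \<Phi> F"
    by (rule cINF_lower[OF Lag_bdd_below])
  with le show "Lag \<Phi> F = (INF V\<in>Cset. Lag \<Phi> V)"
    using Lag_front[OF F] by simp
qed

lemma Lag_attains_minimum: "\<exists>Winf\<in>Cset. \<forall>W\<in>Cset. Lag \<Phi> Winf \<le> Lag \<Phi> W"
proof -
  let ?I = "INF V\<in>Cset. Lag \<Phi> V" and ?K = "integral\<^sup>L lborel (dens Wsh)"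
  have "Wsh \<in> Cset" by (rule front_in_Cset[OF front_Wsh]) simp
  then have ne: "Lag \<Phi> ` Cset \<noteq> {}" by blast
  have ex: "\<exists>V. front V \<and> centred V \<and> integrable lborel (dens V) \<and>
      ?I + ?K \<le> integral\<^sup>L lborel (dens V) \<and> integral\<^sup>L lborel (dens V) \<le> ?I + ?K + inverse (real (Suc n))" for n
  proof -
    have "?I < ?I + inverse (real (Suc n))" by simp
    then obtain W where W: "W \<in> Cset" "Lag \<Phi> W < ?I + inverse (real (Suc n))"
      using cInf_lessD[OF ne] by blast
    obtain V where V: "front V" "AE x in lebesgue. W x = V x" "integrable lborel (\<lambda>x. (Wsh x - V x)\<^sup>2)"
      "W \<in> borel_measurable lebesgue"
      by (rule Cset_representative[OF W(1)])
    have Lag: "Lag \<Phi> W = integral\<^sup>L lborel (dens V) - ?K"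
      by (rule Lag_eq[OF _ V(1,3,2,4)])
    have low: "?I \<le> Lag \<Phi> W" by (rule cINF_lower[OF Lag_bdd_below W(1)])
    \<comment> \<open>Elements of \<open>Cset\<close> need not change sign at 0. Translation repairs
      this and leaves the integral of \<open>dens\<close> unchanged.\<close>
    obtain a where a: "front (\<lambda>x. V (x + a))" "centred (\<lambda>x. V (x + a))"
      by (rule front_centred_shift[OF V(1)])
    note shift = integral_dens_shift[OF V(1) integrable_dens[OF V(1,3)], of a]
    show ?thesis
      by (rule exI[of _ "\<lambda>x. V (x + a)"]) (use a shift Lag low W(2) in auto)
  qed
  then obtain V where V: "\<And>n. front (V n)" "\<And>n. centred (V n)" "\<And>n. integrable lborel (dens (V n))"
    and lo: "\<And>n. ?I + ?K \<le> integral\<^sup>L lborel (dens (V n))"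
    and hi: "\<And>n. integral\<^sup>L lborel (dens (V n)) \<le> ?I + ?K + inverse (real (Suc n))"
    by metis
  have "(\<lambda>n. ?I + ?K + inverse (real (Suc n))) \<longlonglongrightarrow> ?I + ?K + 0"
    by (intro tendsto_add tendsto_const LIMSEQ_inverse_real_of_nat)
  then have hi_lim: "(\<lambda>n. ?I + ?K + inverse (real (Suc n))) \<longlonglongrightarrow> ?I + ?K" by (simp only: add_0_right)
  have Klim: "(\<lambda>n. integral\<^sup>L lborel (dens (V n))) \<longlonglongrightarrow> ?I + ?K"
    by (rule tendsto_sandwich[OF _ _ tendsto_const hi_lim])
       (rule always_eventually, rule allI, rule lo, rule always_eventually, rule allI, rule hi)
  obtain r F where "strict_mono (r :: nat \<Rightarrow> nat)" and F: "front F" "centred F"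
    "integrable lborel (\<lambda>x. (Wsh x - F x)\<^sup>2)" "integral\<^sup>L lborel (dens F) \<le> ?I + ?K"
    by (rule bounded_energy_compactness[OF front_imp_profile[OF V(1)] V(2,3) Klim])
  note min = front_attains_infimum[OF F(1,3,4)]
  show ?thesis
    by (rule bexI[OF _ min(1)]) (use min(2) cINF_lower[OF Lag_bdd_below] in simp)
qed

lemma minimising_sequence_strongly_compact:
  assumes W: "\<And>n. W n \<in> C0set" and lim: "(\<lambda>n. Lag \<Phi> (W n)) \<longlonglongrightarrow> (INF V\<in>Cset. Lag \<Phi> V)"
  shows "\<exists>r G. strict_mono r \<and> G \<in> L2 \<and>
    (\<lambda>n. integral\<^sup>L lebesgue (\<lambda>x. (Wsh x - W (r n) x - G x)\<^sup>2)) \<longlonglongrightarrow> 0"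
proof -
  let ?I = "INF V\<in>Cset. Lag \<Phi> V" and ?K = "integral\<^sup>L lborel (dens Wsh)"
  have "\<exists>V. front V \<and> centred V \<and> (AE x in lebesgue. W n x = V x) \<and>
    integrable lborel (\<lambda>x. (Wsh x - V x)\<^sup>2) \<and> W n \<in> borel_measurable lebesgue" for n
    by (rule C0set_representative[OF W]) blast
  then obtain V where V: "\<And>n. front (V n)" "\<And>n. centred (V n)" "\<And>n. AE x in lebesgue. W n x = V n x"
    "\<And>n. integrable lborel (\<lambda>x. (Wsh x - V n x)\<^sup>2)" "\<And>n. W n \<in> borel_measurable lebesgue"
    by metis
  note P = front_imp_profile[OF V(1)]
  have Lag: "integral\<^sup>L lborel (dens (V n)) = Lag \<Phi> (W n) + ?K" for n
    using Lag_eq[OF _ V(1,4,3,5)] by simp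
  note dint = integrable_dens[OF V(1,4)]
  have Klim: "(\<lambda>n. integral\<^sup>L lborel (dens (V n))) \<longlonglongrightarrow> ?I + ?K"
    unfolding Lag by (intro tendsto_intros lim)
  obtain r F where r: "strict_mono (r :: nat \<Rightarrow> nat)" and F: "front F" "centred F"
    "integrable lborel (\<lambda>x. (Wsh x - F x)\<^sup>2)" "integral\<^sup>L lborel (dens F) \<le> ?I + ?K"
    and ae: "AE x in lborel. (\<lambda>n. V (r n) x) \<longlonglongrightarrow> F x"
    by (rule bounded_energy_compactness[OF P V(2) dint Klim])
  \<comment> \<open>Fatou's lemma gives only an upper bound, but \<open>F\<close> lies in
    \<open>Cset\<close> and so cannot go below the infimum. Hence no energy is lost in the limit,
    which is what strong convergence needs.\<close>
  have "integral\<^sup>L lborel (dens F) = ?I + ?K"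
    using front_attains_infimum(2)[OF F(1,3,4)] Lag_front[OF F(1,3)] by simp
  then have "(\<lambda>n. integral\<^sup>L lborel (dens (V (r n)))) \<longlonglongrightarrow> integral\<^sup>L lborel (dens F)"
    using LIMSEQ_subseq_LIMSEQ[OF Klim r] by (simp add: o_def)
  then have strong: "(\<lambda>n. \<integral>x. (V (r n) x - F x)\<^sup>2 \<partial>lborel) \<longlonglongrightarrow> 0"
    by (intro L2_convergence_of_energy_convergence P V(2) dint front_imp_profile F(1,2) integrable_dens F(3) ae)
  have eq: "(\<integral>x. (Wsh x - W n x - (Wsh x - F x))\<^sup>2 \<partial>lebesgue) = (\<integral>x. (V n x - F x)\<^sup>2 \<partial>lborel)" for n
  proof -
    have Fm: "F \<in> borel_measurable lborel"
      using profile_measurable[OF front_imp_profile[OF F(1)]] by simp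
    have m: "(\<lambda>x. (V n x - F x)\<^sup>2) \<in> borel_measurable lborel"
      using profile_measurable[OF P, of n] Fm by measurable
    have "(\<integral>x. (W n x - F x)\<^sup>2 \<partial>lebesgue) = (\<integral>x. (V n x - F x)\<^sup>2 \<partial>lebesgue)"
    proof (rule integral_cong_AE)
      show "(\<lambda>x. (W n x - F x)\<^sup>2) \<in> borel_measurable lebesgue"
        by (intro borel_measurable_power borel_measurable_diff V(5) measurable_completion[OF Fm])
      show "AE x in lebesgue. (W n x - F x)\<^sup>2 = (V n x - F x)\<^sup>2"
        using V(3)[of n] by eventually_elim simp
    qed (rule measurable_completion[OF m])
    also have "\<dots> = (\<integral>x. (V n x - F x)\<^sup>2 \<partial>lborel)"
      by (rule integral_completion[OF m])
    finally show ?thesis by (simp add: power2_commute[of "F _"])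
  qed
  show ?thesis
    by (rule exI[of _ r], rule exI[of _ "\<lambda>x. Wsh x - F x"])
       (simp only: eq strong r front_L2[OF F(1,3)] simp_thms)
qed

end

section \<open>From the potential to the double well\<close>

text \<open>A convex function lies above its tangent at \<open>b\<close>, which is zero here. The
  mean value theorem is applied to \<open>f'\<close> and then to \<open>f\<close>, with derivatives
  relative to the interval so that \<open>b\<close> may be an endpoint of the domain.\<close>

lemma nonneg_of_convex_critical_zero:
  fixes f f' f'' :: "real \<Rightarrow> real"
  assumes f: "\<And>x. x \<in> {a..b} \<Longrightarrow> (f has_real_derivative f' x) (at x within {a..b})"
    and f': "\<And>x. x \<in> {a..b} \<Longrightarrow> (f' has_real_derivative f'' x) (at x within {a..b})"
    and nn: "\<And>x. x \<in> {a..b} \<Longrightarrow> 0 \<le> f'' x" and "f b = 0" "f' b = 0" and x: "x \<in> {a..b}"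
  shows "0 \<le> f x"
proof -
  have mvt: "\<exists>z\<in>{x..b}. h b - h x = h' z * (b - x)"
    if h: "\<And>x. x \<in> {a..b} \<Longrightarrow> (h has_real_derivative h' x) (at x within {a..b})" and x: "x \<in> {a..b}" for h h' x
  proof -
    have "\<exists>z\<in>{x..b}. h b - h x = (\<lambda>y. h' z * y) (b - x)"
    proof (rule mvt_very_simple[where f' = "\<lambda>z y. h' z * y"])
      fix z assume "x \<le> z" "z \<le> b"
      with x have "(h has_real_derivative h' z) (at z within {x..b})"
        by (intro DERIV_subset[OF h]) auto
      then show "(h has_derivative (\<lambda>y. h' z * y)) (at z within {x..b})"
        by (simp add: has_field_derivative_def)
    qed (use x in simp)
    then show ?thesis by simp
  qed
  have f'_le: "f' z \<le> 0" if z: "z \<in> {a..b}" for z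
  proof -
    obtain y where "y \<in> {z..b}" "f' b - f' z = f'' y * (b - z)" using mvt[OF f' z] by blast
    moreover have "0 \<le> f'' y * (b - z)" using z nn[of y] \<open>y \<in> {z..b}\<close> by (intro mult_nonneg_nonneg) auto
    ultimately show ?thesis using \<open>f' b = 0\<close> by simp
  qed
  obtain y where y: "y \<in> {x..b}" "f b - f x = f' y * (b - x)" using mvt[OF f x] by blast
  moreover have "f' y * (b - x) \<le> 0"
    using x y(1) f'_le[of y] by (intro mult_nonpos_nonneg) auto
  ultimately show ?thesis using \<open>f b = 0\<close> by simp
qed

lemma quadratic_bounds_at_minimum:
  fixes f f' f'' :: "real \<Rightarrow> real"
  assumes f: "\<And>x. x \<in> {0..1} \<Longrightarrow> (f has_real_derivative f' x) (at x within {0..1})"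
    and f': "\<And>x. x \<in> {0..1} \<Longrightarrow> (f' has_real_derivative f'' x) (at x within {0..1})"
    and cont: "continuous_on {0..1} f''" and "f 1 = 0" "f' 1 = 0" and pos: "0 < f'' 1"
    and fpos: "\<And>x. 0 \<le> x \<Longrightarrow> x < 1 \<Longrightarrow> 0 < f x"
  obtains c C where "0 < c" "\<And>x. x \<in> {0..1} \<Longrightarrow> c * (1 - x)\<^sup>2 \<le> f x" "\<And>x. x \<in> {0..1} \<Longrightarrow> f x \<le> C * (1 - x)\<^sup>2"
proof -
  have D: "((\<lambda>x. s * f x + k / 2 * (1 - x)\<^sup>2) has_real_derivative s * f' x - k * (1 - x)) (at x within {d..1})"
       "((\<lambda>x. s * f' x - k * (1 - x)) has_real_derivative s * f'' x + k) (at x within {d..1})"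
    if "0 \<le> d" "x \<in> {d..1}" for s k d x
  proof -
    have 1: "(f has_real_derivative f' x) (at x within {d..1})"
      by (rule DERIV_subset[OF f]) (use that in auto)
    have 2: "(f' has_real_derivative f'' x) (at x within {d..1})"
      by (rule DERIV_subset[OF f']) (use that in auto)
    show "((\<lambda>x. s * f x + k / 2 * (1 - x)\<^sup>2) has_real_derivative s * f' x - k * (1 - x)) (at x within {d..1})"
      by (auto intro!: derivative_eq_intros 1 simp: field_simps)
    show "((\<lambda>x. s * f' x - k * (1 - x)) has_real_derivative s * f'' x + k) (at x within {d..1})"
      by (auto intro!: derivative_eq_intros 2)
  qed
  \<comment> \<open>One comparison serves both directions: \<open>s = -1\<close> with
    \<open>k\<close> the maximum of \<open>f''\<close> gives the upper bound, \<open>s = 1\<close>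
    with a negative \<open>k\<close> the lower bound near 1.\<close>
  have taylor: "0 \<le> s * f x + k / 2 * (1 - x)\<^sup>2"
    if "0 \<le> d" "\<And>x. x \<in> {d..1} \<Longrightarrow> 0 \<le> s * f'' x + k" "x \<in> {d..1}" for s k d x
    by (rule nonneg_of_convex_critical_zero[where a = d and b = 1, OF D(1) D(2) that(2) _ _ that(3)])
       (use that(1) \<open>f 1 = 0\<close> \<open>f' 1 = 0\<close> in auto)
  have "\<exists>xm\<in>{0..1}. \<forall>x\<in>{0..1}. f'' x \<le> f'' xm"
    by (rule continuous_attains_sup[OF _ _ cont]) auto
  then obtain xm where xm: "\<And>x. x \<in> {0..1} \<Longrightarrow> f'' x \<le> f'' xm" by blast
  have upper: "f x \<le> f'' xm / 2 * (1 - x)\<^sup>2" if "x \<in> {0..1}" for x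
    using taylor[of 0 "-1" "f'' xm" x] xm that by simp
  \<comment> \<open>By continuity \<open>f''\<close> stays above half its value at 1 on some
    \<open>{p..1}\<close>; on \<open>{0..p}\<close> compactness and positivity of \<open>f\<close>
    take over, since \<open>(1 - x)\<^sup>2 \<le> 1\<close> there.\<close>
  define m where "m = f'' 1 / 2"
  have "0 < m" using pos by (simp add: m_def)
  obtain d where d: "0 < d" "\<And>x. x \<in> {0..1} \<Longrightarrow> dist x 1 < d \<Longrightarrow> dist (f'' x) (f'' 1) < m"
    using cont[unfolded continuous_on_iff, rule_format, OF _ \<open>0 < m\<close>, of 1] by auto
  define p where "p = max 0 (1 - d / 2)"
  have p: "0 \<le> p" "p < 1" using d(1) by (auto simp: p_def)
  have near: "m / 2 * (1 - x)\<^sup>2 \<le> f x" if "x \<in> {p..1}" for x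
  proof -
    have "0 \<le> 1 * f'' z + - m" if "z \<in> {p..1}" for z
    proof -
      have "dist (f'' z) (f'' 1) < m"
        using that d(1) by (intro d(2)) (auto simp: p_def dist_real_def)
      then have "f'' 1 - f'' z < m" by (simp add: dist_real_def abs_less_iff)
      then show ?thesis by (simp add: m_def)
    qed
    from taylor[OF p(1) this that] show ?thesis by simp
  qed
  have "continuous_on {0..p} f"
    by (rule continuous_on_subset[OF DERIV_continuous_on[OF f]]) (use p in auto)
  then have "\<exists>xq\<in>{0..p}. \<forall>x\<in>{0..p}. f xq \<le> f x"
    using p by (intro continuous_attains_inf) auto
  then obtain xq where xq: "xq \<in> {0..p}" "\<And>x. x \<in> {0..p} \<Longrightarrow> f xq \<le> f x" by blast
  have "0 < f xq" using xq p by (intro fpos) auto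
  have lower: "min (m / 2) (f xq) * (1 - x)\<^sup>2 \<le> f x" if x: "x \<in> {0..1}" for x
  proof (cases "p \<le> x")
    case True
    have "min (m / 2) (f xq) * (1 - x)\<^sup>2 \<le> m / 2 * (1 - x)\<^sup>2"
      by (intro mult_right_mono) auto
    with near[of x] True x show ?thesis by simp
  next
    case False
    have "(1 - x)\<^sup>2 \<le> 1" using x by (simp add: abs_square_le_1)
    then have "min (m / 2) (f xq) * (1 - x)\<^sup>2 \<le> f xq * 1"
      using \<open>0 < f xq\<close> by (intro mult_mono) auto
    also have "\<dots> \<le> f x" using xq(2)[of x] False x by simp
    finally show ?thesis .
  qed
  show ?thesis
    by (rule that[of "min (m / 2) (f xq)", OF _ lower upper]) (use \<open>0 < m\<close> \<open>0 < f xq\<close> in auto)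
qed

text \<open>\<open>h\<close> has nondegenerate minima of value 0 at both ends:
  \<open>\<Phi> (-1) = \<Phi> 1\<close> equalises the values, the conditions on
  \<open>\<Phi>'\<close> make the ends critical, and \<open>\<Phi>'' < 1\<close> there gives a
  positive second derivative.\<close>

lemma front_lagrangian_of_potential:
  fixes \<Phi> \<Phi>' \<Phi>'' :: "real \<Rightarrow> real"
  assumes d1: "\<And>x. x \<in> {-1..1} \<Longrightarrow> (\<Phi> has_real_derivative \<Phi>' x) (at x within {-1..1})"
      and d2: "\<And>x. x \<in> {-1..1} \<Longrightarrow> (\<Phi>' has_real_derivative \<Phi>'' x) (at x within {-1..1})"
      and c2: "continuous_on {-1..1} \<Phi>''"
      and bc: "\<Phi>' (-1) = -1" "\<Phi>' 1 = 1"
      and sym: "\<Phi> (-1) = \<Phi> 1"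
      and sub: "\<Phi>'' (-1) < 1" "\<Phi>'' 1 < 1"
      and gpos: "\<And>w. w \<in> {-1<..<1} \<Longrightarrow> integral {-1..w} (\<lambda>v. v - \<Phi>' v) > 0"
  obtains g c C where "front_lagrangian g c C \<Phi> (1/2 - \<Phi> 1)"
proof -
  define h where "h w = w\<^sup>2 / 2 - \<Phi> w - (1/2 - \<Phi> 1)" for w
  have dh: "(h has_real_derivative x - \<Phi>' x) (at x within {-1..1})" if "x \<in> {-1..1}" for x
    unfolding h_def by (auto intro!: derivative_eq_intros d1[OF that])
  have dh': "((\<lambda>x. x - \<Phi>' x) has_real_derivative 1 - \<Phi>'' x) (at x within {-1..1})" if "x \<in> {-1..1}" for x
    by (auto intro!: derivative_eq_intros d2[OF that])
  have h1: "h 1 = 0" "h (-1) = 0" using sym by (simp_all add: h_def)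
  have hpos: "0 < h w" if "w \<in> {-1<..<1}" for w
  proof -
    have "((\<lambda>v. v - \<Phi>' v) has_integral (h w - h (-1))) {-1..w}"
    proof (rule fundamental_theorem_of_calculus)
      show "(h has_vector_derivative x - \<Phi>' x) (at x within {- 1..w})" if "x \<in> {-1..w}" for x
        unfolding has_real_derivative_iff_has_vector_derivative[symmetric]
        by (rule DERIV_subset[OF dh]) (use that \<open>w \<in> {-1<..<1}\<close> in auto)
    qed (use that in simp)
    then have "integral {-1..w} (\<lambda>v. v - \<Phi>' v) = h w - h (-1)" by (rule integral_unique)
    with gpos[OF that] h1 show ?thesis by simp
  qed
  obtain c1 C1 where 1: "0 < c1" "\<And>x. x \<in> {0..1} \<Longrightarrow> c1 * (1 - x)\<^sup>2 \<le> h x"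
    "\<And>x. x \<in> {0..1} \<Longrightarrow> h x \<le> C1 * (1 - x)\<^sup>2"
  proof (rule quadratic_bounds_at_minimum)
    show "(h has_real_derivative x - \<Phi>' x) (at x within {0..1})" if "x \<in> {0..1}" for x
      by (rule DERIV_subset[OF dh]) (use that in auto)
    show "((\<lambda>x. x - \<Phi>' x) has_real_derivative 1 - \<Phi>'' x) (at x within {0..1})" if "x \<in> {0..1}" for x
      by (rule DERIV_subset[OF dh']) (use that in auto)
    show "continuous_on {0..1} (\<lambda>x. 1 - \<Phi>'' x)"
      by (intro continuous_intros continuous_on_subset[OF c2]) auto
  qed (use h1 bc sub hpos in auto)
  \<comment> \<open>The well at -1 is treated by reflection, through \<open>h (- x)\<close>.\<close>
  obtain c2 C2 where 2: "0 < c2" "\<And>x. x \<in> {0..1} \<Longrightarrow> c2 * (1 - x)\<^sup>2 \<le> h (- x)"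
    "\<And>x. x \<in> {0..1} \<Longrightarrow> h (- x) \<le> C2 * (1 - x)\<^sup>2"
  proof (rule quadratic_bounds_at_minimum)
    have img: "uminus ` {0..1} \<subseteq> {-1..1::real}" by auto
    show "((\<lambda>x. h (- x)) has_real_derivative - (- x - \<Phi>' (- x))) (at x within {0..1})" if "x \<in> {0..1}" for x
    proof -
      have "(h has_real_derivative - x - \<Phi>' (- x)) (at (- x) within uminus ` {0..1})"
        by (rule DERIV_subset[OF dh img]) (use that in auto)
      then have "(h \<circ> uminus has_real_derivative (- x - \<Phi>' (- x)) * (- 1)) (at x within {0..1})"
        by (rule DERIV_image_chain) (auto intro!: derivative_eq_intros)
      then show ?thesis by (simp add: o_def)
    qed
    show "((\<lambda>x. - (- x - \<Phi>' (- x))) has_real_derivative 1 - \<Phi>'' (- x)) (at x within {0..1})" if "x \<in> {0..1}" for x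
    proof -
      have "((\<lambda>x. x - \<Phi>' x) has_real_derivative 1 - \<Phi>'' (- x)) (at (- x) within uminus ` {0..1})"
        by (rule DERIV_subset[OF dh' img]) (use that in auto)
      then have "((\<lambda>x. x - \<Phi>' x) \<circ> uminus has_real_derivative (1 - \<Phi>'' (- x)) * (- 1)) (at x within {0..1})"
        by (rule DERIV_image_chain) (auto intro!: derivative_eq_intros)
      from DERIV_minus[OF this] show ?thesis by (simp add: o_def)
    qed
    show "continuous_on {0..1} (\<lambda>x. 1 - \<Phi>'' (- x))"
      by (intro continuous_intros continuous_on_compose2[OF c2]) auto
  qed (use h1 bc sub hpos in auto)
  have hlow: "min c1 c2 * (1 - \<bar>w\<bar>)\<^sup>2 \<le> h w" if w: "\<bar>w\<bar> \<le> 1" for w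
  proof (cases "0 \<le> w")
    case True
    have "min c1 c2 * (1 - w)\<^sup>2 \<le> c1 * (1 - w)\<^sup>2" by (intro mult_right_mono) auto
    also have "\<dots> \<le> h w" by (rule 1(2)) (use w True in simp)
    finally show ?thesis using True by simp
  next
    case False
    have "min c1 c2 * (1 - (- w))\<^sup>2 \<le> c2 * (1 - (- w))\<^sup>2" by (intro mult_right_mono) auto
    also have "\<dots> \<le> h (- (- w))" by (rule 2(2)) (use w False in simp)
    finally show ?thesis using False by simp
  qed
  have hup: "h w \<le> max C1 C2 * (1 - \<bar>w\<bar>)\<^sup>2" if w: "\<bar>w\<bar> \<le> 1" for w
  proof (cases "0 \<le> w")
    case True
    have "h w \<le> C1 * (1 - w)\<^sup>2" by (rule 1(3)) (use w True in simp)
    also have "\<dots> \<le> max C1 C2 * (1 - w)\<^sup>2" by (intro mult_right_mono) auto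
    finally show ?thesis using True by simp
  next
    case False
    have "h (- (- w)) \<le> C2 * (1 - (- w))\<^sup>2" by (rule 2(3)) (use w False in simp)
    also have "\<dots> \<le> max C1 C2 * (1 - (- w))\<^sup>2" by (intro mult_right_mono) auto
    finally show ?thesis using False by simp
  qed
  \<comment> \<open>The hypotheses say nothing about \<open>\<Phi>\<close> outside
    \<open>[-1,1]\<close>; clamping the argument gives a continuous function on the whole
    line.\<close>
  define g where "g w = h (max (-1) (min 1 w))" for w
  have gh: "g w = h w" if "\<bar>w\<bar> \<le> 1" for w
    using that by (auto simp: g_def abs_le_iff max_def min_def)
  have "continuous_on UNIV g"
    unfolding g_def by (rule continuous_on_compose2[OF DERIV_continuous_on[OF dh]]) (auto intro!: continuous_intros)
  then have "front_lagrangian g (min c1 c2) (max C1 C2) \<Phi> (1/2 - \<Phi> 1)"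
    by unfold_locales (use 1(1) 2(1) hlow hup gh in \<open>auto simp: h_def\<close>)
  then show ?thesis by (rule that)
qed

theorem theorem3p14:
  fixes \<Phi> \<Phi>' \<Phi>'' :: "real \<Rightarrow> real"
  assumes d1: "\<And>x. x \<in> {-1..1} \<Longrightarrow> (\<Phi> has_real_derivative \<Phi>' x) (at x within {-1..1})"
      and d2: "\<And>x. x \<in> {-1..1} \<Longrightarrow> (\<Phi>' has_real_derivative \<Phi>'' x) (at x within {-1..1})"
      and c2: "continuous_on {-1..1} \<Phi>''"
      and bc: "\<Phi>' (-1) = -1" "\<Phi>' 1 = 1"
      and conv: "\<And>x. x \<in> {-1..1} \<Longrightarrow> \<Phi>'' x \<ge> 0"
      and sym: "\<Phi> (-1) = \<Phi> 1"
      and sub: "\<Phi>'' (-1) < 1" "\<Phi>'' 1 < 1"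
      and gpos: "\<And>w. w \<in> {-1<..<1} \<Longrightarrow> integral {-1..w} (\<lambda>v. v - \<Phi>' v) > 0"
  shows "(\<exists>Winf\<in>Cset. \<forall>W\<in>Cset. Lag \<Phi> Winf \<le> Lag \<Phi> W)
     \<and> (\<forall>Wt Wtinf. (\<forall>n. Wt n \<in> C0tilde) \<and> Wtinf \<in> C0tilde \<and> weak_L2_conv Wt Wtinf \<longrightarrow>
          ereal (Lag \<Phi> (\<lambda>x. Wsh x - Wtinf x))
            \<le> liminf (\<lambda>n. ereal (Lag \<Phi> (\<lambda>x. Wsh x - Wt n x))))
     \<and> (\<forall>W. (\<forall>n. W n \<in> C0set) \<and> (\<lambda>n. Lag \<Phi> (W n)) \<longlonglongrightarrow> (INF V\<in>Cset. Lag \<Phi> V) \<longrightarrow>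
          (\<exists>r G. strict_mono r \<and> G \<in> L2 \<and>
             (\<lambda>n. integral\<^sup>L lebesgue (\<lambda>x. (Wsh x - W (r n) x - G x)\<^sup>2)) \<longlonglongrightarrow> 0))"
proof -
  obtain g c C where "front_lagrangian g c C \<Phi> (1/2 - \<Phi> 1)"
    by (rule front_lagrangian_of_potential[OF d1 d2 c2 bc sym sub gpos])
  then interpret front_lagrangian g c C \<Phi> "1/2 - \<Phi> 1" .
  show ?thesis
    by (intro conjI allI impI; (elim conjE)?)
       (rule Lag_attains_minimum Lag_weakly_lower_semicontinuous minimising_sequence_strongly_compact; blast)+
qed

end
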